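(* Let $(M,g_M)$ be a connected Riemannian manifold of dimension $m>1$, let $\mathcal{T}_M$ be the total space of its tangent bundle, and let $\mu,\lambda:\mathcal{T}_M\to(0,+\infty)$ be smooth functions. Let $\omega$ be the non-degenerate 2-form on $\mathcal{T}_M$ associated with the weighted almost-Hermitian structure $(g,J)$ defined by $\mu,\lambda$ (see context). Then $\omega$ is closed if and only if the product $\mu\lambda$ is constant on $\mathcal{T}_M$.
   Context: Let $\pi:\mathcal{T}_M\to M$ be the projection and $\nabla$ the Levi-Civita connection of $g_M$. It induces a splitting $T\mathcal{T}_M=H^\nabla\oplus V$, where $V=\ker \mathrm{d}\pi$ is the vertical bundle and $H^\nabla$ the horizontal distribution; both are canonically isomorphic to $\pi^*TM$. For $u\in\mathcal{T}_M$ and $w\in T_{\pi(u)}M$, denote by $w^h\in H^\nabla_u$ and $w^v\in V_u$ the horizontal and vertical lifts. The weighted metric $g$ on $\mathcal{T}_M$ makes $H^\nabla$ and $V$ orthogonal and satisfies $g(w^h,z^h)=\mu^2 g_M(w,z)$, $g(w^v,z^v)=\lambda^2 g_M(w,z)$. The $g$-compatible almost-complex structure $J$ is defined by $J(w^h)=\frac{\mu}{\lambda}w^v$, $J(w^v)=-\frac{\lambda}{\mu}w^h$. The associated 2-form is $\omega(X,Y)=g(JX,Y)$. *)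

theory Defs
  imports "HOL-Analysis.Analysis"
begin

section \<open>Smooth maps between Euclidean spaces\<close>

primrec Ck_on :: "nat \<Rightarrow> 'a::real_normed_vector set \<Rightarrow> ('a \<Rightarrow> 'b::real_normed_vector) \<Rightarrow> bool" where
  "Ck_on 0 S f \<longleftrightarrow> continuous_on S f"
| "Ck_on (Suc k) S f \<longleftrightarrow>
     (\<forall>x\<in>S. f differentiable (at x)) \<and> (\<forall>v. Ck_on k S (\<lambda>x. frechet_derivative f (at x) v))"

text \<open>Only used on open sets.\<close>

definition smooth_on :: "'a::real_normed_vector set \<Rightarrow> ('a \<Rightarrow> 'b::real_normed_vector) \<Rightarrow> bool" where
  "smooth_on S f \<longleftrightarrow> (\<forall>k. Ck_on k S f)"


section \<open>Smooth manifolds\<close>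

text \<open>
  A chart is a coordinate domain together with a coordinate map, whose values outside the domain
  are irrelevant.  A manifold is given by an atlas (not necessarily maximal); its points are the
  points covered by the atlas, and its topology is the one for which the charts are
  homeomorphisms from open sets onto open sets of the model space.  The dimension is the
  dimension of the model space.
\<close>

type_synonym ('a, 'e) chart = "'a set \<times> ('a \<Rightarrow> 'e)"

definition chart_inv :: "('a, 'e) chart \<Rightarrow> 'e \<Rightarrow> 'a" where
  "chart_inv c = inv_into (fst c) (snd c)"

definition carrier :: "('a, 'e) chart set \<Rightarrow> 'a set" where
  "carrier A = (\<Union>c\<in>A. fst c)"

definition charts_at :: "('a, 'e) chart set \<Rightarrow> 'a \<Rightarrow> ('a, 'e) chart set" where
  "charts_at A p = {c \<in> A. p \<in> fst c}"

definition smooth_atlas :: "('a, 'e::euclidean_space) chart set \<Rightarrow> bool" where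
  "smooth_atlas A \<longleftrightarrow>
     (\<forall>c\<in>A. inj_on (snd c) (fst c) \<and> open (snd c ` fst c)) \<and>
     (\<forall>c\<in>A. \<forall>d\<in>A. open (snd c ` (fst c \<inter> fst d)) \<and>
        smooth_on (snd c ` (fst c \<inter> fst d)) (snd d \<circ> chart_inv c))"

definition manifold_topology :: "('a, 'e::euclidean_space) chart set \<Rightarrow> 'a topology" where
  "manifold_topology A =
     topology (\<lambda>W. W \<subseteq> carrier A \<and> (\<forall>c\<in>A. open (snd c ` (W \<inter> fst c))))"

lemma openin_manifold_topology:
  assumes "smooth_atlas A"
  shows "openin (manifold_topology A) W \<longleftrightarrow>
           W \<subseteq> carrier A \<and> (\<forall>c\<in>A. open (snd c ` (W \<inter> fst c)))"
proof -
  let ?P = "\<lambda>W. W \<subseteq> carrier A \<and> (\<forall>c\<in>A. open (snd c ` (W \<inter> fst c)))"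
  have "istopology ?P"
    unfolding istopology_def
  proof (intro conjI allI impI ballI)
    fix S T c assume S: "?P S" and T: "?P T" and c: "c \<in> A"
    have inj: "inj_on (snd c) (fst c)"
      using assms c by (auto simp: smooth_atlas_def)
    have "snd c ` (S \<inter> T \<inter> fst c) = snd c ` (S \<inter> fst c) \<inter> snd c ` (T \<inter> fst c)"
      using inj by (auto simp: inj_on_def)
    then show "open (snd c ` (S \<inter> T \<inter> fst c))"
      using S T c by auto
  next
    fix K c assume K: "\<forall>S\<in>K. ?P S" and c: "c \<in> A"
    have "snd c ` (\<Union>K \<inter> fst c) = (\<Union>S\<in>K. snd c ` (S \<inter> fst c))" by auto
    then show "open (snd c ` (\<Union>K \<inter> fst c))"
      using K c by auto
  qed blast+
  then show ?thesis
    by (simp add: manifold_topology_def topology_inverse')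
qed

lemma topspace_manifold_topology:
  assumes "smooth_atlas A"
  shows "topspace (manifold_topology A) = carrier A"
proof -
  have "snd c ` (carrier A \<inter> fst c) = snd c ` fst c" if "c \<in> A" for c
    using that by (auto simp: carrier_def)
  then have "openin (manifold_topology A) (carrier A)"
    using assms by (auto simp: openin_manifold_topology smooth_atlas_def)
  then show ?thesis
    using assms by (metis openin_manifold_topology openin_subset openin_topspace subset_antisym)
qed

definition smooth_manifold :: "('a, 'e::euclidean_space) chart set \<Rightarrow> bool" where
  "smooth_manifold A \<longleftrightarrow> smooth_atlas A \<and>
     Hausdorff_space (manifold_topology A) \<and> second_countable (manifold_topology A)"

definition smooth_fun ::
    "('a, 'e::euclidean_space) chart set \<Rightarrow> 'a set \<Rightarrow> ('a \<Rightarrow> real) \<Rightarrow> bool" where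
  "smooth_fun A W f \<longleftrightarrow> (\<forall>c\<in>A. smooth_on (snd c ` (W \<inter> fst c)) (f \<circ> chart_inv c))"


section \<open>Tangent vectors\<close>

text \<open>
  A tangent vector at \<open>p\<close> is the family of its coordinate representations in the charts
  around \<open>p\<close>, related by the derivatives of the transition maps.  It is extended by 0
  to all other charts, so that it is uniquely determined and the operations are pointwise.
\<close>

type_synonym ('a, 'e) tvec = "('a, 'e) chart \<Rightarrow> 'e"

definition tangent_space ::
    "('a, 'e::euclidean_space) chart set \<Rightarrow> 'a \<Rightarrow> ('a, 'e) tvec set" where
  "tangent_space A p =
     {v. (\<forall>c. c \<notin> charts_at A p \<longrightarrow> v c = 0) \<and>
         (\<forall>c\<in>charts_at A p. \<forall>d\<in>charts_at A p.
            v d = frechet_derivative (snd d \<circ> chart_inv c) (at (snd c p)) (v c))}"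

definition tzero :: "('a, 'e::euclidean_space) tvec" where
  "tzero = (\<lambda>c. 0)"

definition tadd ::
    "('a, 'e::euclidean_space) tvec \<Rightarrow> ('a, 'e) tvec \<Rightarrow> ('a, 'e) tvec" where
  "tadd v w = (\<lambda>c. v c + w c)"

definition tscale :: "real \<Rightarrow> ('a, 'e::euclidean_space) tvec \<Rightarrow> ('a, 'e) tvec" where
  "tscale r v = (\<lambda>c. r *\<^sub>R v c)"

text \<open>The tangent vector at \<open>p\<close> whose representation in the chart \<open>c\<close> is \<open>e\<close>.\<close>

definition coord_vec ::
    "('a, 'e::euclidean_space) chart set \<Rightarrow> ('a, 'e) chart \<Rightarrow> 'a \<Rightarrow> 'e \<Rightarrow> ('a, 'e) tvec" where
  "coord_vec A c p e =
     (\<lambda>d. if d \<in> charts_at A p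
          then frechet_derivative (snd d \<circ> chart_inv c) (at (snd c p)) e else 0)"

definition chart_deriv ::
    "('a, 'e::euclidean_space) chart \<Rightarrow> 'a \<Rightarrow> ('a, 'e) tvec \<Rightarrow> ('a \<Rightarrow> 'b::real_normed_vector) \<Rightarrow> 'b"
  where "chart_deriv c p v f = frechet_derivative (f \<circ> chart_inv c) (at (snd c p)) (v c)"

text \<open>The derivative \<open>v(f)\<close>; for \<open>f\<close> differentiable at \<open>p\<close> the choice of the chart does not matter.\<close>

definition dir_deriv ::
    "('a, 'e::euclidean_space) chart set \<Rightarrow> 'a \<Rightarrow> ('a, 'e) tvec \<Rightarrow> ('a \<Rightarrow> 'b::real_normed_vector) \<Rightarrow> 'b"
  where "dir_deriv A p v f = chart_deriv (SOME c. c \<in> charts_at A p) p v f"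

definition differential ::
    "('a, 'e::euclidean_space) chart set \<Rightarrow> ('b, 'f::euclidean_space) chart set \<Rightarrow>
     ('a \<Rightarrow> 'b) \<Rightarrow> 'a \<Rightarrow> ('a, 'e) tvec \<Rightarrow> ('b, 'f) tvec" where
  "differential A B F p v =
     (\<lambda>d. if d \<in> charts_at B (F p) then dir_deriv A p v (snd d \<circ> F) else 0)"

definition velocity ::
    "('a, 'e::euclidean_space) chart set \<Rightarrow> (real \<Rightarrow> 'a) \<Rightarrow> real \<Rightarrow> ('a, 'e) tvec" where
  "velocity A \<gamma> t =
     (\<lambda>d. if d \<in> charts_at A (\<gamma> t) then vector_derivative (snd d \<circ> \<gamma>) (at t) else 0)"

definition smooth_vf ::
    "('a, 'e::euclidean_space) chart set \<Rightarrow> 'a set \<Rightarrow> ('a \<Rightarrow> ('a, 'e) tvec) \<Rightarrow> bool" where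
  "smooth_vf A W X \<longleftrightarrow> (\<forall>p\<in>W. X p \<in> tangent_space A p) \<and>
     (\<forall>c\<in>A. smooth_on (snd c ` (W \<inter> fst c)) (\<lambda>x. X (chart_inv c x) c))"

definition lie_bracket ::
    "('a, 'e::euclidean_space) chart set \<Rightarrow> ('a \<Rightarrow> ('a, 'e) tvec) \<Rightarrow> ('a \<Rightarrow> ('a, 'e) tvec) \<Rightarrow>
     'a \<Rightarrow> ('a, 'e) tvec" where
  "lie_bracket A X Y p =
     (\<lambda>c. if c \<in> charts_at A p
          then chart_deriv c p (X p) (\<lambda>q. Y q c) - chart_deriv c p (Y p) (\<lambda>q. X q c) else 0)"


section \<open>The tangent bundle as a manifold\<close>

definition tangent_bundle ::
    "('a, 'e::euclidean_space) chart set \<Rightarrow> ('a \<times> ('a, 'e) tvec) set" where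
  "tangent_bundle A = {(p, v). p \<in> carrier A \<and> v \<in> tangent_space A p}"

definition tangent_chart ::
    "('a, 'e::euclidean_space) chart set \<Rightarrow> ('a, 'e) chart \<Rightarrow>
     ('a \<times> ('a, 'e) tvec, 'e \<times> 'e) chart" where
  "tangent_chart A c =
     ({u \<in> tangent_bundle A. fst u \<in> fst c}, \<lambda>u. (snd c (fst u), snd u c))"

definition tangent_atlas ::
    "('a, 'e::euclidean_space) chart set \<Rightarrow> ('a \<times> ('a, 'e) tvec, 'e \<times> 'e) chart set" where
  "tangent_atlas A = tangent_chart A ` A"


section \<open>Tensors and differential 2-forms\<close>

definition linear_tangent ::
    "('a, 'e::euclidean_space) tvec set \<Rightarrow> (('a, 'e) tvec \<Rightarrow> real) \<Rightarrow> bool" where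
  "linear_tangent T f \<longleftrightarrow>
     (\<forall>v\<in>T. \<forall>w\<in>T. f (tadd v w) = f v + f w) \<and> (\<forall>r. \<forall>v\<in>T. f (tscale r v) = r * f v)"

definition endomorphism_tangent ::
    "('a, 'e::euclidean_space) tvec set \<Rightarrow> (('a, 'e) tvec \<Rightarrow> ('a, 'e) tvec) \<Rightarrow> bool" where
  "endomorphism_tangent T f \<longleftrightarrow> (\<forall>v\<in>T. f v \<in> T) \<and>
     (\<forall>v\<in>T. \<forall>w\<in>T. f (tadd v w) = tadd (f v) (f w)) \<and>
     (\<forall>r. \<forall>v\<in>T. f (tscale r v) = tscale r (f v))"

definition symmetric_bilinear_tangent ::
    "('a, 'e::euclidean_space) tvec set \<Rightarrow> (('a, 'e) tvec \<Rightarrow> ('a, 'e) tvec \<Rightarrow> real) \<Rightarrow> bool" where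
  "symmetric_bilinear_tangent T b \<longleftrightarrow>
     (\<forall>v\<in>T. linear_tangent T (b v)) \<and> (\<forall>v\<in>T. \<forall>w\<in>T. b v w = b w v)"

definition riemannian_metric ::
    "('a, 'e::euclidean_space) chart set \<Rightarrow>
     ('a \<Rightarrow> ('a, 'e) tvec \<Rightarrow> ('a, 'e) tvec \<Rightarrow> real) \<Rightarrow> bool" where
  "riemannian_metric A g \<longleftrightarrow>
     (\<forall>p\<in>carrier A. symmetric_bilinear_tangent (tangent_space A p) (g p) \<and>
        (\<forall>v\<in>tangent_space A p. v \<noteq> tzero \<longrightarrow> g p v v > 0)) \<and>
     (\<forall>c\<in>A. \<forall>a b. smooth_fun A (fst c) (\<lambda>p. g p (coord_vec A c p a) (coord_vec A c p b)))"

text \<open>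
  The exterior derivative of a 2-form in a chart: the arguments are extended to vector fields
  with constant coefficients in the chart, so that the bracket terms of the invariant formula
  vanish.
\<close>

definition ext_deriv ::
    "('a, 'e::euclidean_space) chart set \<Rightarrow> ('a, 'e) chart \<Rightarrow>
     ('a \<Rightarrow> ('a, 'e) tvec \<Rightarrow> ('a, 'e) tvec \<Rightarrow> real) \<Rightarrow>
     'a \<Rightarrow> ('a, 'e) tvec \<Rightarrow> ('a, 'e) tvec \<Rightarrow> ('a, 'e) tvec \<Rightarrow> real" where
  "ext_deriv A c \<omega> p X Y Z =
     chart_deriv c p X (\<lambda>q. \<omega> q (coord_vec A c q (Y c)) (coord_vec A c q (Z c)))
   - chart_deriv c p Y (\<lambda>q. \<omega> q (coord_vec A c q (X c)) (coord_vec A c q (Z c)))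
   + chart_deriv c p Z (\<lambda>q. \<omega> q (coord_vec A c q (X c)) (coord_vec A c q (Y c)))"

definition closed_form ::
    "('a, 'e::euclidean_space) chart set \<Rightarrow>
     ('a \<Rightarrow> ('a, 'e) tvec \<Rightarrow> ('a, 'e) tvec \<Rightarrow> real) \<Rightarrow> bool" where
  "closed_form A \<omega> \<longleftrightarrow>
     (\<forall>c\<in>A. \<forall>p\<in>fst c. \<forall>X\<in>tangent_space A p. \<forall>Y\<in>tangent_space A p. \<forall>Z\<in>tangent_space A p.
        ext_deriv A c \<omega> p X Y Z = 0)"


section \<open>The Levi-Civita connection\<close>

text \<open>
  A connection \<open>nabla p w Y\<close> differentiates a vector field \<open>Y\<close>, smooth on some neighbourhood of
  \<open>p\<close>, in the direction \<open>w \<in> T\<^sub>pM\<close>.  Connections on global vector fields extend uniquely to such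
  local ones.  Values of \<open>Y\<close> away from the neighbourhood are arbitrary; by the Leibniz rule they
  do not matter.
\<close>

definition connection ::
    "('a, 'e::euclidean_space) chart set \<Rightarrow>
     ('a \<Rightarrow> ('a, 'e) tvec \<Rightarrow> ('a \<Rightarrow> ('a, 'e) tvec) \<Rightarrow> ('a, 'e) tvec) \<Rightarrow> bool" where
  "connection A nabla \<longleftrightarrow>
     (\<forall>W X Y. openin (manifold_topology A) W \<and> smooth_vf A W X \<and> smooth_vf A W Y \<longrightarrow>
        smooth_vf A W (\<lambda>p. nabla p (X p) Y)) \<and>
     (\<forall>W Y. openin (manifold_topology A) W \<and> smooth_vf A W Y \<longrightarrow>
        (\<forall>p\<in>W. endomorphism_tangent (tangent_space A p) (\<lambda>w. nabla p w Y))) \<and>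
     (\<forall>W Y Z. openin (manifold_topology A) W \<and> smooth_vf A W Y \<and> smooth_vf A W Z \<longrightarrow>
        (\<forall>p\<in>W. \<forall>w\<in>tangent_space A p.
           nabla p w (\<lambda>q. tadd (Y q) (Z q)) = tadd (nabla p w Y) (nabla p w Z))) \<and>
     (\<forall>W f Y. openin (manifold_topology A) W \<and> smooth_fun A W f \<and> smooth_vf A W Y \<longrightarrow>
        (\<forall>p\<in>W. \<forall>w\<in>tangent_space A p.
           nabla p w (\<lambda>q. tscale (f q) (Y q)) =
             tadd (tscale (dir_deriv A p w f) (Y p)) (tscale (f p) (nabla p w Y))))"

definition torsion_free ::
    "('a, 'e::euclidean_space) chart set \<Rightarrow>
     ('a \<Rightarrow> ('a, 'e) tvec \<Rightarrow> ('a \<Rightarrow> ('a, 'e) tvec) \<Rightarrow> ('a, 'e) tvec) \<Rightarrow> bool" where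
  "torsion_free A nabla \<longleftrightarrow>
     (\<forall>W X Y. openin (manifold_topology A) W \<and> smooth_vf A W X \<and> smooth_vf A W Y \<longrightarrow>
        (\<forall>p\<in>W. nabla p (X p) Y = tadd (nabla p (Y p) X) (lie_bracket A X Y p)))"

definition metric_compatible ::
    "('a, 'e::euclidean_space) chart set \<Rightarrow>
     ('a \<Rightarrow> ('a, 'e) tvec \<Rightarrow> ('a, 'e) tvec \<Rightarrow> real) \<Rightarrow>
     ('a \<Rightarrow> ('a, 'e) tvec \<Rightarrow> ('a \<Rightarrow> ('a, 'e) tvec) \<Rightarrow> ('a, 'e) tvec) \<Rightarrow> bool" where
  "metric_compatible A g nabla \<longleftrightarrow>
     (\<forall>W Y Z. openin (manifold_topology A) W \<and> smooth_vf A W Y \<and> smooth_vf A W Z \<longrightarrow>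
        (\<forall>p\<in>W. \<forall>w\<in>tangent_space A p.
           dir_deriv A p w (\<lambda>q. g q (Y q) (Z q)) = g p (nabla p w Y) (Z p) + g p (Y p) (nabla p w Z)))"

definition levi_civita ::
    "('a, 'e::euclidean_space) chart set \<Rightarrow>
     ('a \<Rightarrow> ('a, 'e) tvec \<Rightarrow> ('a, 'e) tvec \<Rightarrow> real) \<Rightarrow>
     ('a \<Rightarrow> ('a, 'e) tvec \<Rightarrow> ('a \<Rightarrow> ('a, 'e) tvec) \<Rightarrow> ('a, 'e) tvec) \<Rightarrow> bool" where
  "levi_civita A g nabla \<longleftrightarrow> connection A nabla \<and> torsion_free A nabla \<and> metric_compatible A g nabla"


section \<open>Horizontal and vertical lifts\<close>

text \<open>
  The horizontal space at \<open>u\<close> consists of the vectors \<open>dY(w)\<close>, where \<open>Y\<close> is a local vector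
  field, seen as a section of the tangent bundle, with \<open>Y(\<pi>(u)) = u\<close> and \<open>nabla w Y = 0\<close>.
\<close>

definition horizontal_space ::
    "('a, 'e::euclidean_space) chart set \<Rightarrow>
     ('a \<Rightarrow> ('a, 'e) tvec \<Rightarrow> ('a \<Rightarrow> ('a, 'e) tvec) \<Rightarrow> ('a, 'e) tvec) \<Rightarrow>
     'a \<times> ('a, 'e) tvec \<Rightarrow> ('a \<times> ('a, 'e) tvec, 'e \<times> 'e) tvec set" where
  "horizontal_space A nabla u =
     {differential A (tangent_atlas A) (\<lambda>q. (q, Y q)) (fst u) w | w W Y.
        w \<in> tangent_space A (fst u) \<and> openin (manifold_topology A) W \<and> fst u \<in> W \<and>
        smooth_vf A W Y \<and> Y (fst u) = snd u \<and> nabla (fst u) w Y = tzero}"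

definition horizontal_lift ::
    "('a, 'e::euclidean_space) chart set \<Rightarrow>
     ('a \<Rightarrow> ('a, 'e) tvec \<Rightarrow> ('a \<Rightarrow> ('a, 'e) tvec) \<Rightarrow> ('a, 'e) tvec) \<Rightarrow>
     'a \<times> ('a, 'e) tvec \<Rightarrow> ('a, 'e) tvec \<Rightarrow> ('a \<times> ('a, 'e) tvec, 'e \<times> 'e) tvec" where
  "horizontal_lift A nabla u w =
     (THE \<xi>. \<xi> \<in> horizontal_space A nabla u \<and> differential (tangent_atlas A) A fst u \<xi> = w)"

text \<open>The canonical identification of \<open>T\<^bsub>\<pi>(u)\<^esub>M\<close> with the kernel of \<open>d\<pi>\<close> at \<open>u\<close>.\<close>

definition vertical_lift ::
    "('a, 'e::euclidean_space) chart set \<Rightarrow>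
     'a \<times> ('a, 'e) tvec \<Rightarrow> ('a, 'e) tvec \<Rightarrow> ('a \<times> ('a, 'e) tvec, 'e \<times> 'e) tvec" where
  "vertical_lift A u w =
     velocity (tangent_atlas A) (\<lambda>t. (fst u, tadd (snd u) (tscale t w))) 0"


section \<open>The weighted almost-Hermitian structure\<close>

text \<open>
  As the tangent space at \<open>u\<close> is the direct sum of the horizontal and the vertical space, the
  values on lifts determine a bilinear form and an endomorphism uniquely.  Positive definiteness
  and smoothness of \<open>g\<close>, as well as \<open>J\<^sup>2 = -1\<close> and compatibility of \<open>J\<close> with \<open>g\<close>, are consequences.
\<close>

definition weighted_metric ::
    "('a, 'e::euclidean_space) chart set \<Rightarrow>
     ('a \<Rightarrow> ('a, 'e) tvec \<Rightarrow> ('a, 'e) tvec \<Rightarrow> real) \<Rightarrow>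
     ('a \<Rightarrow> ('a, 'e) tvec \<Rightarrow> ('a \<Rightarrow> ('a, 'e) tvec) \<Rightarrow> ('a, 'e) tvec) \<Rightarrow>
     ('a \<times> ('a, 'e) tvec \<Rightarrow> real) \<Rightarrow> ('a \<times> ('a, 'e) tvec \<Rightarrow> real) \<Rightarrow>
     ('a \<times> ('a, 'e) tvec \<Rightarrow> ('a \<times> ('a, 'e) tvec, 'e \<times> 'e) tvec \<Rightarrow>
        ('a \<times> ('a, 'e) tvec, 'e \<times> 'e) tvec \<Rightarrow> real) \<Rightarrow> bool" where
  "weighted_metric A gM nabla \<mu> lam g \<longleftrightarrow>
     (\<forall>u\<in>tangent_bundle A.
        symmetric_bilinear_tangent (tangent_space (tangent_atlas A) u) (g u) \<and>
        (\<forall>w\<in>tangent_space A (fst u). \<forall>z\<in>tangent_space A (fst u).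
           g u (horizontal_lift A nabla u w) (vertical_lift A u z) = 0 \<and>
           g u (horizontal_lift A nabla u w) (horizontal_lift A nabla u z) = (\<mu> u)\<^sup>2 * gM (fst u) w z \<and>
           g u (vertical_lift A u w) (vertical_lift A u z) = (lam u)\<^sup>2 * gM (fst u) w z))"

definition weighted_acs ::
    "('a, 'e::euclidean_space) chart set \<Rightarrow>
     ('a \<Rightarrow> ('a, 'e) tvec \<Rightarrow> ('a \<Rightarrow> ('a, 'e) tvec) \<Rightarrow> ('a, 'e) tvec) \<Rightarrow>
     ('a \<times> ('a, 'e) tvec \<Rightarrow> real) \<Rightarrow> ('a \<times> ('a, 'e) tvec \<Rightarrow> real) \<Rightarrow>
     ('a \<times> ('a, 'e) tvec \<Rightarrow> ('a \<times> ('a, 'e) tvec, 'e \<times> 'e) tvec \<Rightarrow>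
        ('a \<times> ('a, 'e) tvec, 'e \<times> 'e) tvec) \<Rightarrow> bool" where
  "weighted_acs A nabla \<mu> lam J \<longleftrightarrow>
     (\<forall>u\<in>tangent_bundle A.
        endomorphism_tangent (tangent_space (tangent_atlas A) u) (J u) \<and>
        (\<forall>w\<in>tangent_space A (fst u).
           J u (horizontal_lift A nabla u w) = tscale (\<mu> u / lam u) (vertical_lift A u w) \<and>
           J u (vertical_lift A u w) = tscale (- (lam u / \<mu> u)) (horizontal_lift A nabla u w)))"

definition fundamental_form ::
    "('b \<Rightarrow> ('b, 'f::euclidean_space) tvec \<Rightarrow> ('b, 'f) tvec \<Rightarrow> real) \<Rightarrow>
     ('b \<Rightarrow> ('b, 'f) tvec \<Rightarrow> ('b, 'f) tvec) \<Rightarrow>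
     'b \<Rightarrow> ('b, 'f) tvec \<Rightarrow> ('b, 'f) tvec \<Rightarrow> real" where
  "fundamental_form g J u X Y = g u (J u X) Y"

end

theory Submission
  imports Defs
begin

text \<open>
  In a chart \<open>x\<close> of \<open>M\<close> with fibre coordinates \<open>y\<close>, the horizontal lift of \<open>a\<close> is
  \<open>(a, - \<Gamma>(a, y))\<close>, and since the connection is metric and torsion free, the fundamental form is
  \<open>- \<mu>\<lambda> d\<theta>\<close> with the 1-form \<open>\<theta>(a, b) = g\<^sub>M(y, a)\<close>.  Hence \<open>d\<omega> = - d(\<mu>\<lambda>) \<and> d\<theta>\<close>.  As \<open>d\<theta>\<close> is
  non-degenerate and the tangent bundle has dimension at least 4, wedging with \<open>d\<theta>\<close> is injective on
  1-forms, so \<open>\<omega>\<close> is closed iff \<open>\<mu>\<lambda>\<close> is locally constant, and the tangent bundle is connected.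
\<close>

section \<open>Calculus in Euclidean spaces\<close>

text \<open>The connection is given as an operator on local fields and the horizontal space by
  differentials of sections parallel at a point, so Christoffel symbols have to be extracted first:
  locality and the Leibniz rule reduce \<open>nabla\<close> to its values on fields with constant
  components in a chart. Metric compatibility turns the derivatives of the metric coefficients in
  d\<theta> into Christoffel terms, and vanishing torsion cancels those that pair y with \<Gamma>(a,
  a'). What remains makes the horizontal and vertical spaces Lagrangian, which is the shape of
  \<omega>. Closedness of d\<theta> is in coordinates the symmetry of second derivatives. The bound
  on the dimension is essential: for m = 1 the bundle is a surface, where every 3-form vanishes. The
  passage from locally constant to constant takes place over M: full preimages of coordinate balls
  serve as neighbourhoods in the bundle, which reduces everything to the zero section.\<close>

lemma frechet_derivative_cong_open:
  assumes "open S" "x \<in> S" "\<And>y. y \<in> S \<Longrightarrow> f y = g y"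
  shows "frechet_derivative f (at x) = frechet_derivative g (at x)"
proof -
  have "(f has_derivative D) (at x) = (g has_derivative D) (at x)" for D
    using assms has_derivative_transform_within_open[of f D x UNIV S g]
      has_derivative_transform_within_open[of g D x UNIV S f] by auto
  then show ?thesis unfolding frechet_derivative_def by simp
qed

lemma differentiable_cong_open:
  assumes "open S" "x \<in> S" "\<And>y. y \<in> S \<Longrightarrow> f y = g y" "f differentiable (at x)"
  shows "g differentiable (at x)"
  using assms has_derivative_transform_within_open[of f _ x UNIV S g]
  unfolding differentiable_def by metis

section \<open>Functions of class C^k on open sets\<close>

lemma Ck_on_cong:
  assumes "open S" "\<And>x. x \<in> S \<Longrightarrow> f x = g x" "Ck_on k S f"
  shows "Ck_on k S g"
  using assms(2,3)
proof (induction k arbitrary: f g)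
  case 0
  then show ?case by (simp cong: continuous_on_cong)
next
  case (Suc k)
  have "g differentiable (at x)" if "x \<in> S" for x
    using differentiable_cong_open[OF \<open>open S\<close> that Suc.prems(1)] Suc.prems(2) that by auto
  moreover have "Ck_on k S (\<lambda>x. frechet_derivative g (at x) v)" for v
  proof (rule Suc.IH)
    show "Ck_on k S (\<lambda>x. frechet_derivative f (at x) v)" using Suc.prems by simp
    show "frechet_derivative f (at x) v = frechet_derivative g (at x) v" if "x \<in> S" for x
      using frechet_derivative_cong_open[of S x f g] assms(1) that Suc.prems(1) by simp
  qed
  ultimately show ?case by simp
qed

lemma Ck_on_subset: "Ck_on k S f \<Longrightarrow> T \<subseteq> S \<Longrightarrow> Ck_on k T f"
  by (induction k arbitrary: f) (auto intro: continuous_on_subset)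

lemma Ck_on_lower: "Ck_on (Suc k) S f \<Longrightarrow> Ck_on k S f"
proof (induction k arbitrary: f)
  case 0
  then show ?case
    by (auto intro!: continuous_at_imp_continuous_on differentiable_imp_continuous_within)
next
  case (Suc k)
  then show ?case
    by (simp only: Ck_on.simps(2)) auto
qed

text \<open>\<open>Ck_on\<close> refers to the chosen \<open>frechet_derivative\<close>; this rule
  accepts an explicit derivative formula \<open>D\<close> instead, so that each closure property
  below becomes an induction on k with the usual differentiation rule.\<close>

lemma Ck_on_SucI:
  assumes "open S" "\<And>x. x \<in> S \<Longrightarrow> (f has_derivative D x) (at x)"
    and "\<And>v. Ck_on k S (\<lambda>x. D x v)"
  shows "Ck_on (Suc k) S f"
proof -
  have eq: "D x = frechet_derivative f (at x)" if "x \<in> S" for x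
    using frechet_derivative_at[OF assms(2)[OF that]] .
  have "f differentiable (at x)" if "x \<in> S" for x
    using assms(2)[OF that] by (auto simp: differentiable_def)
  moreover have "Ck_on k S (\<lambda>x. frechet_derivative f (at x) v)" for v
    by (rule Ck_on_cong[OF assms(1) _ assms(3)[of v]]) (simp add: eq)
  ultimately show ?thesis by simp
qed

lemma Ck_on_Suc_has_derivative:
  "Ck_on (Suc k) S f \<Longrightarrow> x \<in> S \<Longrightarrow> (f has_derivative frechet_derivative f (at x)) (at x)"
  by (simp add: frechet_derivative_works)

lemma Ck_on_const: "open S \<Longrightarrow> Ck_on k S (\<lambda>x. c)"
  by (induction k arbitrary: c) auto

lemma Ck_on_linear:
  assumes "open S" "bounded_linear L" "Ck_on k S f"
  shows "Ck_on k S (\<lambda>x. L (f x))"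
  using assms(3)
proof (induction k arbitrary: f)
  case 0
  then show ?case
    using bounded_linear.continuous_on[OF assms(2)] by auto
next
  case (Suc k)
  show ?case
  proof (rule Ck_on_SucI[OF assms(1)])
    show "((\<lambda>x. L (f x)) has_derivative (\<lambda>v. L (frechet_derivative f (at x) v))) (at x)"
      if "x \<in> S" for x
      using bounded_linear.has_derivative[OF assms(2) Ck_on_Suc_has_derivative[OF Suc.prems that]] .
    show "Ck_on k S (\<lambda>x. L (frechet_derivative f (at x) v))" for v
      using Suc by simp
  qed
qed

lemma Ck_on_add:
  assumes "open S" "Ck_on k S f" "Ck_on k S g"
  shows "Ck_on k S (\<lambda>x. f x + g x)"
  using assms(2,3)
proof (induction k arbitrary: f g)
  case 0
  then show ?case by (auto intro: continuous_on_add)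
next
  case (Suc k)
  show ?case
  proof (rule Ck_on_SucI[OF assms(1)])
    show "((\<lambda>x. f x + g x) has_derivative
        (\<lambda>v. frechet_derivative f (at x) v + frechet_derivative g (at x) v)) (at x)"
      if "x \<in> S" for x
      using has_derivative_add[OF Suc.prems[THEN Ck_on_Suc_has_derivative, OF that]] .
    show "Ck_on k S (\<lambda>x. frechet_derivative f (at x) v + frechet_derivative g (at x) v)" for v
      using Suc by simp
  qed
qed

lemma Ck_on_sum:
  assumes "open S" "\<And>i. i \<in> I \<Longrightarrow> Ck_on k S (f i)"
  shows "Ck_on k S (\<lambda>x. \<Sum>i\<in>I. f i x)"
  using assms(2)
proof (induction I rule: infinite_finite_induct)
  case (insert i I)
  then show ?case
    using Ck_on_add[OF assms(1), of k "f i" "\<lambda>x. \<Sum>i\<in>I. f i x"] by simp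
qed (simp_all add: Ck_on_const assms(1))

lemma Ck_on_scaleR:
  assumes "open S" "Ck_on k S f" "Ck_on k S g"
  shows "Ck_on k S (\<lambda>x. f x *\<^sub>R g x)"
  using assms(2,3)
proof (induction k arbitrary: f g)
  case 0
  then show ?case by (auto intro: continuous_on_scaleR)
next
  case (Suc k)
  show ?case
  proof (rule Ck_on_SucI[OF assms(1)])
    show "((\<lambda>x. f x *\<^sub>R g x) has_derivative
        (\<lambda>v. f x *\<^sub>R frechet_derivative g (at x) v + frechet_derivative f (at x) v *\<^sub>R g x)) (at x)"
      if "x \<in> S" for x
      using has_derivative_scaleR[OF Suc.prems[THEN Ck_on_Suc_has_derivative, OF that]] .
    show "Ck_on k S (\<lambda>x. f x *\<^sub>R frechet_derivative g (at x) v + frechet_derivative f (at x) v *\<^sub>R g x)" for v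
      \<comment> \<open>The product rule keeps f and g themselves next to derivatives of one order
        less, so their own order is lowered to match.\<close>
      using Suc.prems Ck_on_lower[OF Suc.prems(1)] Ck_on_lower[OF Suc.prems(2)]
      by (auto intro!: Ck_on_add assms(1) Suc.IH)
  qed
qed

lemma linear_basis_expansion:
  assumes "linear L"
  shows "L v = (\<Sum>i\<in>Basis. (v \<bullet> i) *\<^sub>R L i)"
proof -
  have "L v = L (\<Sum>i\<in>Basis. (v \<bullet> i) *\<^sub>R i)" by (simp only: euclidean_representation)
  also have "\<dots> = (\<Sum>i\<in>Basis. (v \<bullet> i) *\<^sub>R L i)"
    by (simp only: linear_sum[OF assms] linear_scale[OF assms])
  finally show ?thesis .
qed

text \<open>In the chain rule the derivative of f is applied to a direction that moves with x, while
  \<open>Ck_on\<close> only controls derivatives in fixed directions. Expanding this direction in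
  the basis of the middle space leaves products of a component of Dg with a partial derivative of f
  composed with g, and the induction hypothesis covers the latter.\<close>

lemma Ck_on_compose:
  fixes f :: "'b::euclidean_space \<Rightarrow> 'c::real_normed_vector"
  assumes "open S" "open T" "g ` S \<subseteq> T" "Ck_on k T f" "Ck_on k S g"
  shows "Ck_on k S (\<lambda>x. f (g x))"
  using assms(4,5)
proof (induction k arbitrary: f)
  case 0
  then show ?case using assms(3) by (auto intro: continuous_on_compose2)
next
  case (Suc k)
  have gT: "g x \<in> T" if "x \<in> S" for x using assms(3) that by auto
  show ?case
  proof (rule Ck_on_SucI[OF assms(1)])
    fix x assume x: "x \<in> S"
    have lin: "linear (frechet_derivative f (at (g x)))"
      using Suc.prems gT[OF x] by (simp add: linear_frechet_derivative)
    have "(f \<circ> g has_derivative frechet_derivative f (at (g x)) \<circ> frechet_derivative g (at x)) (at x)"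
      using Ck_on_Suc_has_derivative[OF Suc.prems(1) gT[OF x]]
        Ck_on_Suc_has_derivative[OF Suc.prems(2) x] by (metis diff_chain_at)
    moreover have "frechet_derivative f (at (g x)) \<circ> frechet_derivative g (at x) =
      (\<lambda>v. \<Sum>i\<in>Basis. (frechet_derivative g (at x) v \<bullet> i) *\<^sub>R frechet_derivative f (at (g x)) i)"
      by (rule ext) (simp only: o_def linear_basis_expansion[OF lin, symmetric])
    ultimately show "((\<lambda>x. f (g x)) has_derivative
      (\<lambda>v. \<Sum>i\<in>Basis. (frechet_derivative g (at x) v \<bullet> i) *\<^sub>R frechet_derivative f (at (g x)) i)) (at x)"
      by (simp add: o_def)
  next
    fix v
    show "Ck_on k S (\<lambda>x. \<Sum>i\<in>Basis. (frechet_derivative g (at x) v \<bullet> i) *\<^sub>R frechet_derivative f (at (g x)) i)"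
    proof (intro Ck_on_sum Ck_on_scaleR assms(1))
      fix i :: 'b
      show "Ck_on k S (\<lambda>x. frechet_derivative g (at x) v \<bullet> i)"
        by (rule Ck_on_linear[OF assms(1) bounded_linear_inner_left]) (use Suc.prems in simp)
      show "Ck_on k S (\<lambda>x. frechet_derivative f (at (g x)) i)"
        using Suc.prems Ck_on_lower[OF Suc.prems(2)] by (intro Suc.IH) auto
    qed
  qed
qed

section \<open>Smooth functions\<close>

lemma smooth_on_cong:
  assumes "open S" "\<And>x. x \<in> S \<Longrightarrow> f x = g x" "smooth_on S f"
  shows "smooth_on S g"
proof -
  have "Ck_on k S g" for k
    by (rule Ck_on_cong[OF assms(1), of f g]) (use assms(2,3) in \<open>auto simp: smooth_on_def\<close>)
  then show ?thesis by (simp add: smooth_on_def)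
qed

lemma smooth_onI: "(\<And>k. Ck_on k S f) \<Longrightarrow> smooth_on S f"
  by (simp add: smooth_on_def)

lemma smooth_onD: "smooth_on S f \<Longrightarrow> Ck_on k S f"
  by (simp add: smooth_on_def)

lemma smooth_on_subset: "smooth_on S f \<Longrightarrow> T \<subseteq> S \<Longrightarrow> smooth_on T f"
  by (rule smooth_onI) (rule Ck_on_subset[OF smooth_onD])

lemma smooth_on_const: "open S \<Longrightarrow> smooth_on S (\<lambda>x. c)"
  by (rule smooth_onI) (rule Ck_on_const)

lemma smooth_on_linear: "open S \<Longrightarrow> bounded_linear L \<Longrightarrow> smooth_on S f \<Longrightarrow> smooth_on S (\<lambda>x. L (f x))"
  by (rule smooth_onI) (rule Ck_on_linear[OF _ _ smooth_onD])

lemma smooth_on_add: "open S \<Longrightarrow> smooth_on S f \<Longrightarrow> smooth_on S g \<Longrightarrow> smooth_on S (\<lambda>x. f x + g x)"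
  by (rule smooth_onI) (rule Ck_on_add[OF _ smooth_onD smooth_onD])

lemma smooth_on_sum:
  "open S \<Longrightarrow> (\<And>i. i \<in> I \<Longrightarrow> smooth_on S (f i)) \<Longrightarrow> smooth_on S (\<lambda>x. \<Sum>i\<in>I. f i x)"
  by (rule smooth_onI) (rule Ck_on_sum[OF _ smooth_onD])

lemma smooth_on_scaleR:
  "open S \<Longrightarrow> smooth_on S f \<Longrightarrow> smooth_on S g \<Longrightarrow> smooth_on S (\<lambda>x. f x *\<^sub>R g x)"
  by (rule smooth_onI) (rule Ck_on_scaleR[OF _ smooth_onD smooth_onD])

lemma smooth_on_compose:
  fixes f :: "'b::euclidean_space \<Rightarrow> 'c::real_normed_vector"
  assumes "open S" "open T" "g ` S \<subseteq> T" "smooth_on T f" "smooth_on S g"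
  shows "smooth_on S (\<lambda>x. f (g x))"
  by (rule smooth_onI) (rule Ck_on_compose[OF assms(1-3) smooth_onD[OF assms(4)] smooth_onD[OF assms(5)]])

lemma smooth_on_differentiable: "smooth_on S f \<Longrightarrow> x \<in> S \<Longrightarrow> f differentiable (at x)"
  using smooth_onD[of S f "Suc 0"] by simp

lemma smooth_on_frechet_derivative:
  assumes "smooth_on S f"
  shows "smooth_on S (\<lambda>x. frechet_derivative f (at x) v)"
proof (rule smooth_onI)
  show "Ck_on k S (\<lambda>x. frechet_derivative f (at x) v)" for k
    using smooth_onD[OF assms, of "Suc k"] by simp
qed

lemma smooth_on_continuous_on: "smooth_on S f \<Longrightarrow> continuous_on S f"
  using smooth_onD[of S f 0] by simp

lemma smooth_on_ident:
  assumes "open S"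
  shows "smooth_on S (\<lambda>x. x)"
proof (rule smooth_onI)
  show "Ck_on k S (\<lambda>x. x)" for k
  proof (cases k)
    case (Suc n)
    then show ?thesis by (auto intro: Ck_on_const[OF assms])
  qed simp
qed

section \<open>Symmetry of second derivatives\<close>

lemma second_difference_mvt:
  fixes f :: "'a::real_normed_vector \<Rightarrow> real"
  assumes f: "smooth_on (ball x r) f" and "s > 0" "s * (norm u + norm v) < r"
  obtains \<xi> where "\<xi> \<in> ball x r"
    "f (x + s *\<^sub>R u + s *\<^sub>R v) - f (x + s *\<^sub>R u) - f (x + s *\<^sub>R v) + f x =
     s * (s * frechet_derivative (\<lambda>y. frechet_derivative f (at y) u) (at \<xi>) v)"
proof -
  let ?Du = "\<lambda>y. frechet_derivative f (at y) u"
  have inb: "x + t *\<^sub>R u + t' *\<^sub>R v \<in> ball x r" if "0 \<le> t" "t \<le> s" "0 \<le> t'" "t' \<le> s" for t t'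
  proof -
    have "norm (t *\<^sub>R u + t' *\<^sub>R v) \<le> t * norm u + t' * norm v"
      using that by (metis abs_of_nonneg norm_scaleR norm_triangle_ineq)
    also have "\<dots> \<le> s * norm u + s * norm v"
      using that by (intro add_mono mult_right_mono) auto
    finally have "norm (t *\<^sub>R u + t' *\<^sub>R v) < r" using assms(3) by (simp add: algebra_simps)
    then show ?thesis
      by (metis add.assoc add_diff_cancel_left' dist_norm dist_commute mem_ball)
  qed
  have der: "((\<lambda>t. h (p + t *\<^sub>R w)) has_derivative (\<lambda>d. d * frechet_derivative h (at (p + t *\<^sub>R w)) w))
      (at t within T)"
    if "smooth_on (ball x r) h" "p + t *\<^sub>R w \<in> ball x r" for h :: "'a \<Rightarrow> real" and p w t T
  proof -
    have h: "(h has_derivative frechet_derivative h (at (p + t *\<^sub>R w))) (at (p + t *\<^sub>R w))"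
      using smooth_on_differentiable[OF that] by (simp add: frechet_derivative_works)
    have "((\<lambda>t. h (p + t *\<^sub>R w)) has_derivative
        (\<lambda>d. frechet_derivative h (at (p + t *\<^sub>R w)) (d *\<^sub>R w))) (at t within T)"
      by (rule has_derivative_compose[where g = h and f = "\<lambda>t. p + t *\<^sub>R w" and f' = "\<lambda>d. d *\<^sub>R w", OF _ h]) (auto intro!: derivative_eq_intros)
    moreover have "linear (frechet_derivative h (at (p + t *\<^sub>R w)))"
      using h has_derivative_linear by blast
    ultimately show ?thesis by (simp add: linear_scale)
  qed
  \<comment> \<open>Mean value theorem in t for the increment f(x + s v + t u) - f(x + t u) between
    0 and s.\<close>
  obtain t where t: "0 < t" "t < s" and
    eq1: "(f (x + s *\<^sub>R v + s *\<^sub>R u) - f (x + s *\<^sub>R u)) - (f (x + s *\<^sub>R v + 0 *\<^sub>R u) - f (x + 0 *\<^sub>R u)) =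
      (s - 0) * ?Du (x + s *\<^sub>R v + t *\<^sub>R u) - (s - 0) * ?Du (x + t *\<^sub>R u)"
  proof -
    have "\<exists>t\<in>{0<..<s}. (f (x + s *\<^sub>R v + s *\<^sub>R u) - f (x + s *\<^sub>R u)) - (f (x + s *\<^sub>R v + 0 *\<^sub>R u) - f (x + 0 *\<^sub>R u)) =
      (s - 0) * ?Du (x + s *\<^sub>R v + t *\<^sub>R u) - (s - 0) * ?Du (x + t *\<^sub>R u)"
    proof (rule mvt_simple[OF \<open>0 < s\<close>])
      fix t assume t: "0 \<le> t" "t \<le> s"
      show "((\<lambda>t. f (x + s *\<^sub>R v + t *\<^sub>R u) - f (x + t *\<^sub>R u)) has_derivative
         (\<lambda>d. d * ?Du (x + s *\<^sub>R v + t *\<^sub>R u) - d * ?Du (x + t *\<^sub>R u))) (at t within {0..s})"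
        by (intro has_derivative_diff der f)
          (use inb[of t s] inb[of t 0] t \<open>0 < s\<close> in \<open>auto simp: algebra_simps\<close>)
    qed
    then show ?thesis using that by auto
  qed
  \<comment> \<open>Second application, now to the derivative along u as a function of the shift in
    direction v.\<close>
  obtain t' where t': "0 < t'" "t' < s" and
    eq2: "?Du (x + t *\<^sub>R u + s *\<^sub>R v) - ?Du (x + t *\<^sub>R u + 0 *\<^sub>R v) =
      (s - 0) * frechet_derivative ?Du (at (x + t *\<^sub>R u + t' *\<^sub>R v)) v"
  proof -
    have "\<exists>t'\<in>{0<..<s}. ?Du (x + t *\<^sub>R u + s *\<^sub>R v) - ?Du (x + t *\<^sub>R u + 0 *\<^sub>R v) =
      (s - 0) * frechet_derivative ?Du (at (x + t *\<^sub>R u + t' *\<^sub>R v)) v"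
    proof (rule mvt_simple[OF \<open>0 < s\<close>])
      fix t' assume t': "0 \<le> t'" "t' \<le> s"
      show "((\<lambda>t'. ?Du (x + t *\<^sub>R u + t' *\<^sub>R v)) has_derivative
         (\<lambda>d. d * frechet_derivative ?Du (at (x + t *\<^sub>R u + t' *\<^sub>R v)) v)) (at t' within {0..s})"
        by (intro der smooth_on_frechet_derivative f)
          (use inb[of t t'] t t' in auto)
    qed
    then show ?thesis using that by auto
  qed
  have sw: "x + s *\<^sub>R v + t *\<^sub>R u = x + t *\<^sub>R u + s *\<^sub>R v" "x + s *\<^sub>R v + s *\<^sub>R u = x + s *\<^sub>R u + s *\<^sub>R v"
    by (simp_all add: algebra_simps)
  have "f (x + s *\<^sub>R u + s *\<^sub>R v) - f (x + s *\<^sub>R u) - f (x + s *\<^sub>R v) + f x =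
     s * (?Du (x + t *\<^sub>R u + s *\<^sub>R v) - ?Du (x + t *\<^sub>R u))"
    using eq1 by (simp add: sw algebra_simps)
  also have "\<dots> = s * (s * frechet_derivative ?Du (at (x + t *\<^sub>R u + t' *\<^sub>R v)) v)"
    using eq2 by simp
  finally show ?thesis
    using that[of "x + t *\<^sub>R u + t' *\<^sub>R v"] inb[of t t'] t t' by auto
qed

text \<open>The second difference is symmetric in u and v, so the two mixed derivatives agree at
  some pair of points of every small ball around x. If they differed at x itself, continuity would
  keep their values apart on such a ball.\<close>

lemma frechet_derivative_commute:
  fixes f :: "'a::real_normed_vector \<Rightarrow> real"
  assumes "open S" "smooth_on S f" "x \<in> S"
  shows "frechet_derivative (\<lambda>y. frechet_derivative f (at y) u) (at x) v =
         frechet_derivative (\<lambda>y. frechet_derivative f (at y) v) (at x) u" (is "?A x = ?B x")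
proof (rule ccontr)
  assume ne: "?A x \<noteq> ?B x"
  \<comment> \<open>Half of the gap: a value within e of \<open>?A x\<close> cannot equal a value
    within e of \<open>?B x\<close>.\<close>
  define e where "e = \<bar>?A x - ?B x\<bar> / 2"
  have e: "e > 0" using ne by (simp add: e_def)
  have cont: "continuous (at x) ?A" "continuous (at x) ?B"
    using assms(2,3)
      smooth_on_continuous_on[OF smooth_on_frechet_derivative[OF smooth_on_frechet_derivative[OF assms(2)]]]
    by (simp_all add: continuous_on_eq_continuous_at[OF assms(1)])
  obtain d1 where d1: "d1 > 0" "\<And>y. dist y x < d1 \<Longrightarrow> dist (?A y) (?A x) < e"
    using cont(1) e unfolding continuous_at_eps_delta by blast
  obtain d2 where d2: "d2 > 0" "\<And>y. dist y x < d2 \<Longrightarrow> dist (?B y) (?B x) < e"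
    using cont(2) e unfolding continuous_at_eps_delta by blast
  obtain d3 where d3: "d3 > 0" "ball x d3 \<subseteq> S"
    using assms(1,3) openE by blast
  define r where "r = min d1 (min d2 d3)"
  have r: "r > 0" using d1 d2 d3 by (simp add: r_def)
  \<comment> \<open>The summand 1 keeps the denominator positive even for u = v = 0 and makes
    \<open>s * (norm u + norm v) < r\<close> strict.\<close>
  define s where "s = r / (norm u + norm v + 1)"
  have s: "s > 0" "s * (norm u + norm v) < r"
  proof -
    have n: "norm u + norm v + 1 > 0" by (simp add: add_nonneg_pos)
    then show "s > 0" using r by (simp add: s_def)
    have "s * (norm u + norm v + 1) = r" using n by (simp add: s_def)
    then show "s * (norm u + norm v) < r" using \<open>s > 0\<close> by (simp add: algebra_simps)
  qed
  have f: "smooth_on (ball x r) f"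
    using d3 by (intro smooth_on_subset[OF assms(2)]) (auto simp: r_def)
  obtain \<xi> where xi: "\<xi> \<in> ball x r"
    "f (x + s *\<^sub>R u + s *\<^sub>R v) - f (x + s *\<^sub>R u) - f (x + s *\<^sub>R v) + f x = s * (s * ?A \<xi>)"
    using second_difference_mvt[OF f s] .
  obtain \<eta> where eta: "\<eta> \<in> ball x r"
    "f (x + s *\<^sub>R v + s *\<^sub>R u) - f (x + s *\<^sub>R v) - f (x + s *\<^sub>R u) + f x = s * (s * ?B \<eta>)"
    using second_difference_mvt[OF f s(1), of v u] s(2) by (auto simp: add.commute)
  have sw: "x + s *\<^sub>R v + s *\<^sub>R u = x + s *\<^sub>R u + s *\<^sub>R v" by (simp add: algebra_simps)
  have "s * (s * ?A \<xi>) = s * (s * ?B \<eta>)"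
    using xi(2) eta(2) unfolding sw by linarith
  then have "?A \<xi> = ?B \<eta>" using s(1) by simp
  moreover have "dist (?A \<xi>) (?A x) < e" "dist (?B \<eta>) (?B x) < e"
    using d1(2)[of \<xi>] d2(2)[of \<eta>] xi(1) eta(1) by (auto simp: r_def dist_commute)
  ultimately show False unfolding e_def dist_real_def by (auto simp: abs_real_def split: if_splits)
qed

text \<open>Expanding y in the basis of the finite-dimensional fibre writes S x y as a sum of
  coordinates of y times functions of x alone, so joint differentiability follows from the product
  rule. This serves both the transition maps of the tangent bundle and the terms of
  \<open>Om\<close> that are linear in the fibre coordinate.\<close>

lemma has_derivative_fibrewise_linear:
  fixes S :: "'a::real_normed_vector \<Rightarrow> 'b::euclidean_space \<Rightarrow> 'c::real_normed_vector"
  assumes "open U" "x \<in> U" and lin: "\<And>x. x \<in> U \<Longrightarrow> linear (S x)"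
    and diff: "\<And>y. (\<lambda>x. S x y) differentiable (at x)"
  shows "((\<lambda>p. S (fst p) (snd p)) has_derivative
           (\<lambda>w. frechet_derivative (\<lambda>x. S x y) (at x) (fst w) + S x (snd w))) (at (x, y))"
proof -
  have D: "((\<lambda>x. S x z) has_derivative frechet_derivative (\<lambda>x. S x z) (at x)) (at x)" for z
    using diff by (simp add: frechet_derivative_works)
  have exp: "S x' z = (\<Sum>i\<in>Basis. (z \<bullet> i) *\<^sub>R S x' i)" if "x' \<in> U" for x' z
    using linear_basis_expansion[OF lin[OF that]] .
  have "((\<lambda>x. \<Sum>i\<in>Basis. (y \<bullet> i) *\<^sub>R S x i) has_derivative
     (\<lambda>a. \<Sum>i\<in>Basis. (y \<bullet> i) *\<^sub>R frechet_derivative (\<lambda>x. S x i) (at x) a)) (at x)"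
    by (intro has_derivative_sum has_derivative_scaleR_right D)
  then have "((\<lambda>x. S x y) has_derivative
     (\<lambda>a. \<Sum>i\<in>Basis. (y \<bullet> i) *\<^sub>R frechet_derivative (\<lambda>x. S x i) (at x) a)) (at x)"
    by (rule has_derivative_transform_within_open[OF _ assms(1,2)]) (rule exp[symmetric])
  then have Dy: "frechet_derivative (\<lambda>x. S x y) (at x) =
     (\<lambda>a. \<Sum>i\<in>Basis. (y \<bullet> i) *\<^sub>R frechet_derivative (\<lambda>x. S x i) (at x) a)"
    by (metis frechet_derivative_at)
  have fst': "((\<lambda>p. S (fst p) i) has_derivative
      (\<lambda>w. frechet_derivative (\<lambda>x. S x i) (at x) (fst w))) (at (x, y))" for i
    by (rule has_derivative_compose[of fst fst "(x, y)" UNIV "\<lambda>x. S x i"])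
      (use D in \<open>auto intro!: derivative_eq_intros\<close>)
  have "((\<lambda>p. \<Sum>i\<in>Basis. (snd p \<bullet> i) *\<^sub>R S (fst p) i) has_derivative
      (\<lambda>w. \<Sum>i\<in>Basis. (y \<bullet> i) *\<^sub>R frechet_derivative (\<lambda>x. S x i) (at x) (fst w) +
                       (snd w \<bullet> i) *\<^sub>R S x i)) (at (x, y))"
    by (intro has_derivative_sum has_derivative_scaleR[of "\<lambda>p. snd p \<bullet> _", simplified] fst')
      (auto intro!: derivative_eq_intros fst')
  then have "((\<lambda>p. \<Sum>i\<in>Basis. (snd p \<bullet> i) *\<^sub>R S (fst p) i) has_derivative
      (\<lambda>w. frechet_derivative (\<lambda>x. S x y) (at x) (fst w) + S x (snd w))) (at (x, y))"
    by (simp only: Dy exp[OF assms(2), symmetric] sum.distrib)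
  moreover have "open (U \<times> (UNIV :: 'b set))" "(x, y) \<in> U \<times> UNIV"
    using assms(1,2) by (auto intro: open_Times)
  ultimately show ?thesis
    by (rule has_derivative_transform_within_open) (auto intro: exp[symmetric])
qed

section \<open>Tangent spaces of manifolds with differentiable transition maps\<close>

text \<open>Charts of the tangent bundle are only needed up to first order, so their smoothness is
  never proved.\<close>

locale diff_atlas =
  fixes B :: "('a, 'e::euclidean_space) chart set"
  assumes inj_chart: "c \<in> B \<Longrightarrow> inj_on (snd c) (fst c)"
    and open_overlap: "c \<in> B \<Longrightarrow> d \<in> B \<Longrightarrow> open (snd c ` (fst c \<inter> fst d))"
    and transition_differentiable: "c \<in> B \<Longrightarrow> d \<in> B \<Longrightarrow> x \<in> snd c ` (fst c \<inter> fst d) \<Longrightarrow>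
      (snd d \<circ> chart_inv c) differentiable (at x)"
begin

definition jac :: "('a, 'e) chart \<Rightarrow> ('a, 'e) chart \<Rightarrow> 'a \<Rightarrow> 'e \<Rightarrow> 'e" where
  "jac c d p = frechet_derivative (snd d \<circ> chart_inv c) (at (snd c p))"

lemma chart_inv_chart [simp]: "c \<in> B \<Longrightarrow> p \<in> fst c \<Longrightarrow> chart_inv c (snd c p) = p"
  by (simp add: chart_inv_def inj_chart)

lemma open_chart: "c \<in> B \<Longrightarrow> open (snd c ` fst c)"
  using open_overlap[of c c] by simp

lemma charts_atD: "c \<in> charts_at B p \<Longrightarrow> c \<in> B" "c \<in> charts_at B p \<Longrightarrow> p \<in> fst c"
  by (auto simp: charts_at_def)

lemma has_derivative_jac:
  assumes "c \<in> charts_at B p" "d \<in> charts_at B p"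
  shows "((snd d \<circ> chart_inv c) has_derivative jac c d p) (at (snd c p))"
proof -
  have "(snd d \<circ> chart_inv c) differentiable (at (snd c p))"
    using assms by (intro transition_differentiable) (auto simp: charts_at_def)
  then show ?thesis by (simp add: jac_def frechet_derivative_works)
qed

lemma linear_jac: "c \<in> charts_at B p \<Longrightarrow> d \<in> charts_at B p \<Longrightarrow> linear (jac c d p)"
  using has_derivative_jac has_derivative_linear by blast

lemma has_derivative_change_chart:
  assumes c: "c \<in> charts_at B p" and d: "d \<in> charts_at B p"
    and f: "((f \<circ> chart_inv d) has_derivative D) (at (snd d p))"
  shows "((f \<circ> chart_inv c) has_derivative (D \<circ> jac c d p)) (at (snd c p))"
proof -
  note cd = charts_atD[OF c] charts_atD[OF d]
  have "(snd d \<circ> chart_inv c) (snd c p) = snd d p" using cd by simp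
  then have "(((f \<circ> chart_inv d) \<circ> (snd d \<circ> chart_inv c)) has_derivative (D \<circ> jac c d p)) (at (snd c p))"
    using diff_chain_at[OF has_derivative_jac[OF c d], of "f \<circ> chart_inv d" D] f by simp
  then show ?thesis
    by (rule has_derivative_transform_within_open[where s = "snd c ` (fst c \<inter> fst d)"])
      (use cd open_overlap[OF cd(1,3)] in auto)
qed

text \<open>The chain rule for transition maps together with uniqueness of the derivative. This
  identity is what makes \<open>coord_vec\<close> a tangent vector.\<close>

lemma jac_cocycle:
  assumes "c \<in> charts_at B p" "d \<in> charts_at B p" "e \<in> charts_at B p"
  shows "jac d e p (jac c d p v) = jac c e p v"
  using has_derivative_change_chart[OF assms(1,2) has_derivative_jac[OF assms(2,3)]]
    has_derivative_jac[OF assms(1,3)] has_derivative_unique by (metis comp_apply)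

lemma jac_self:
  assumes c: "c \<in> charts_at B p"
  shows "jac c c p v = v"
proof -
  note cd = charts_atD[OF c]
  have "((\<lambda>x. x) has_derivative (\<lambda>x. x)) (at (snd c p))" by (rule has_derivative_ident)
  then have "((snd c \<circ> chart_inv c) has_derivative (\<lambda>x. x)) (at (snd c p))"
    by (rule has_derivative_transform_within_open[where s = "snd c ` fst c"])
      (use cd open_chart[OF cd(1)] in auto)
  with has_derivative_jac[OF c c] have "jac c c p = (\<lambda>x. x)"
    by (rule has_derivative_unique)
  then show ?thesis by simp
qed

lemma coord_vec_apply: "d \<in> charts_at B p \<Longrightarrow> coord_vec B c p e d = jac c d p e"
  by (simp add: coord_vec_def jac_def)

lemma coord_vec_self: "c \<in> charts_at B p \<Longrightarrow> coord_vec B c p e c = e"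
  by (simp add: coord_vec_apply jac_self)

lemma tangent_space_iff:
  "v \<in> tangent_space B p \<longleftrightarrow> (\<forall>c. c \<notin> charts_at B p \<longrightarrow> v c = 0) \<and>
     (\<forall>c\<in>charts_at B p. \<forall>d\<in>charts_at B p. v d = jac c d p (v c))"
  by (simp add: tangent_space_def jac_def)

lemma tangent_jac:
  "v \<in> tangent_space B p \<Longrightarrow> c \<in> charts_at B p \<Longrightarrow> d \<in> charts_at B p \<Longrightarrow> jac c d p (v c) = v d"
  unfolding tangent_space_iff by (rule sym) blast

lemma tangent_outside: "v \<in> tangent_space B p \<Longrightarrow> c \<notin> charts_at B p \<Longrightarrow> v c = 0"
  unfolding tangent_space_iff by blast

lemma tangent_spaceI:
  assumes "\<And>c. c \<notin> charts_at B p \<Longrightarrow> v c = 0"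
    and "\<And>c d. c \<in> charts_at B p \<Longrightarrow> d \<in> charts_at B p \<Longrightarrow> jac c d p (v c) = v d"
  shows "v \<in> tangent_space B p"
  unfolding tangent_space_iff by (auto simp: assms)

lemma coord_vec_in: "c \<in> charts_at B p \<Longrightarrow> coord_vec B c p e \<in> tangent_space B p"
  by (simp add: tangent_space_iff coord_vec_apply jac_cocycle) (simp add: coord_vec_def)

lemma coord_vec_component:
  assumes "v \<in> tangent_space B p" "c \<in> charts_at B p"
  shows "coord_vec B c p (v c) = v"
proof
  fix d
  show "coord_vec B c p (v c) d = v d"
  proof (cases "d \<in> charts_at B p")
    case True
    then show ?thesis using assms by (simp add: coord_vec_apply tangent_jac)
  next
    case False
    then show ?thesis using assms by (simp add: coord_vec_def tangent_outside)
  qed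
qed

lemma tangent_eqI:
  "v \<in> tangent_space B p \<Longrightarrow> w \<in> tangent_space B p \<Longrightarrow> c \<in> charts_at B p \<Longrightarrow> v c = w c \<Longrightarrow> v = w"
  by (metis coord_vec_component)

lemma tadd_in: "v \<in> tangent_space B p \<Longrightarrow> w \<in> tangent_space B p \<Longrightarrow> tadd v w \<in> tangent_space B p"
  by (rule tangent_spaceI) (auto simp: tadd_def linear_jac linear_add tangent_outside tangent_jac)

lemma tscale_in: "v \<in> tangent_space B p \<Longrightarrow> tscale r v \<in> tangent_space B p"
  by (rule tangent_spaceI) (auto simp: tscale_def linear_jac linear_scale tangent_outside tangent_jac)

lemma tzero_in: "tzero \<in> tangent_space B p"
  by (rule tangent_spaceI) (auto simp: tzero_def linear_jac linear_0)

lemma coord_vec_add: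
  "c \<in> charts_at B p \<Longrightarrow> coord_vec B c p (a + b) = tadd (coord_vec B c p a) (coord_vec B c p b)"
  by (rule tangent_eqI[where p = p and c = c])
    (simp_all add: coord_vec_in tadd_in coord_vec_self, simp add: tadd_def coord_vec_self)

lemma coord_vec_scale:
  "c \<in> charts_at B p \<Longrightarrow> coord_vec B c p (r *\<^sub>R a) = tscale r (coord_vec B c p a)"
  by (rule tangent_eqI[where p = p and c = c])
    (simp_all add: coord_vec_in tscale_in coord_vec_self, simp add: tscale_def coord_vec_self)

lemma some_chart: "c \<in> charts_at B p \<Longrightarrow> (SOME c. c \<in> charts_at B p) \<in> charts_at B p"
  by (metis someI)

text \<open>\<open>dir_deriv\<close> works in a chart picked by choice. The Jacobian that the chain
  rule produces is absorbed by the transformation law of the components of v, so the derivative may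
  be read off in any convenient chart.\<close>

lemma dir_deriv_chart:
  fixes f :: "'a \<Rightarrow> 'b::real_normed_vector"
  assumes c: "c \<in> charts_at B p" and v: "v \<in> tangent_space B p"
    and f: "((f \<circ> chart_inv c) has_derivative D) (at (snd c p))"
  shows "dir_deriv B p v f = D (v c)"
proof -
  define d where "d = (SOME c. c \<in> charts_at B p)"
  have d: "d \<in> charts_at B p" using some_chart[OF c] by (simp add: d_def)
  have "frechet_derivative (f \<circ> chart_inv d) (at (snd d p)) = D \<circ> jac d c p"
    using frechet_derivative_at[OF has_derivative_change_chart[OF d c f]] by simp
  then show ?thesis
    using tangent_jac[OF v d c] by (simp add: dir_deriv_def chart_deriv_def flip: d_def)
qed

lemma differential_apply:
  assumes "c \<in> charts_at B p" "w \<in> tangent_space B p" "d \<in> charts_at C (F p)"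
    and "((\<lambda>x. snd d (F (chart_inv c x))) has_derivative D) (at (snd c p))"
  shows "differential B C F p w d = D (w c)"
  using dir_deriv_chart[OF assms(1,2), of "snd d \<circ> F" D] assms(3,4)
  by (simp add: differential_def o_def)

text \<open>The coordinate expressions of F in two target charts differ by a transition map near the
  point, so the chain rule gives the transformation law. \<open>V d\<close> is a coordinate
  neighbourhood that F maps into the domain of d, and it may depend on d.\<close>

lemma differential_in:
  fixes C :: "('b, 'f::euclidean_space) chart set"
  assumes "diff_atlas C" and c: "c \<in> charts_at B p" and w: "w \<in> tangent_space B p"
    and V: "\<And>d. d \<in> charts_at C (F p) \<Longrightarrow> open (V d)" "\<And>d. d \<in> charts_at C (F p) \<Longrightarrow> snd c p \<in> V d"
    and F: "\<And>d x. d \<in> charts_at C (F p) \<Longrightarrow> x \<in> V d \<Longrightarrow> F (chart_inv c x) \<in> fst d"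
    and D: "\<And>d. d \<in> charts_at C (F p) \<Longrightarrow>
      ((\<lambda>x. snd d (F (chart_inv c x))) has_derivative D d) (at (snd c p))"
  shows "differential B C F p w \<in> tangent_space C (F p)"
proof -
  interpret C: diff_atlas C by fact
  have "D d (w c) = C.jac e d (F p) (D e (w c))"
    if e: "e \<in> charts_at C (F p)" and d: "d \<in> charts_at C (F p)" for d e
  proof -
    note ed = C.charts_atD[OF e] C.charts_atD[OF d]
    have Fp: "F (chart_inv c (snd c p)) = F p" using charts_atD[OF c] by simp
    have "((snd d \<circ> chart_inv e) has_derivative C.jac e d (F p)) (at (snd e (F (chart_inv c (snd c p)))))"
      using C.has_derivative_jac[OF e d] Fp by simp
    from diff_chain_at[OF D[OF e] this]
    have "((snd d \<circ> chart_inv e \<circ> (\<lambda>x. snd e (F (chart_inv c x)))) has_derivative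
        (C.jac e d (F p) \<circ> D e)) (at (snd c p))" .
    then have "((\<lambda>x. snd d (F (chart_inv c x))) has_derivative (C.jac e d (F p) \<circ> D e)) (at (snd c p))"
    proof (rule has_derivative_transform_within_open)
      show "open (V e)" "snd c p \<in> V e" by (fact V(1)[OF e], fact V(2)[OF e])
      fix x assume "x \<in> V e"
      then have "F (chart_inv c x) \<in> fst e" by (rule F[OF e])
      then show "(snd d \<circ> chart_inv e \<circ> (\<lambda>x. snd e (F (chart_inv c x)))) x = snd d (F (chart_inv c x))"
        using ed by simp
    qed
    with D[OF d] have "D d = C.jac e d (F p) \<circ> D e" by (rule has_derivative_unique)
    then show ?thesis by simp
  qed
  note trans = this
  have app: "differential B C F p w d = D d (w c)" if "d \<in> charts_at C (F p)" for d
    by (rule differential_apply[OF c w that D[OF that]])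
  show ?thesis
  proof (rule C.tangent_spaceI)
    show "differential B C F p w d = 0" if "d \<notin> charts_at C (F p)" for d
      using that by (simp add: differential_def)
    show "C.jac e d (F p) (differential B C F p w e) = differential B C F p w d"
      if e: "e \<in> charts_at C (F p)" and d: "d \<in> charts_at C (F p)" for e d
      unfolding app[OF e] app[OF d] by (rule trans[OF e d, symmetric])
  qed
qed

end

locale smooth_atlas_structure =
  fixes A :: "('a, 'e::euclidean_space) chart set"
  assumes smooth_atlas: "smooth_atlas A"
begin

sublocale diff_atlas A
proof
  fix c d x assume cd: "c \<in> A" "d \<in> A"
  then show "inj_on (snd c) (fst c)" "open (snd c ` (fst c \<inter> fst d))"
    using smooth_atlas by (auto simp: smooth_atlas_def)
  show "(snd d \<circ> chart_inv c) differentiable (at x)" if "x \<in> snd c ` (fst c \<inter> fst d)"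
    using smooth_atlas cd that smooth_on_differentiable unfolding smooth_atlas_def by blast
qed

lemma smooth_transition:
  "c \<in> A \<Longrightarrow> d \<in> A \<Longrightarrow> smooth_on (snd c ` (fst c \<inter> fst d)) (snd d \<circ> chart_inv c)"
  using smooth_atlas by (simp add: smooth_atlas_def)

lemma openin_chart_image:
  "openin (manifold_topology A) W \<Longrightarrow> c \<in> A \<Longrightarrow> open (snd c ` (W \<inter> fst c))"
  using openin_manifold_topology[OF smooth_atlas] by auto

lemma openin_chart:
  assumes "c \<in> A"
  shows "openin (manifold_topology A) (fst c)"
  unfolding openin_manifold_topology[OF smooth_atlas]
  using open_overlap[OF _ assms] assms by (auto simp: carrier_def Int_commute)

text \<open>\<open>smooth_fun\<close> demands smoothness in every chart. For W inside one chart
  domain, composition with the transition maps carries it from that chart to all others.\<close>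

lemma smooth_fun_chartI:
  assumes c: "c \<in> A" and W: "openin (manifold_topology A) W" "W \<subseteq> fst c"
    and f: "smooth_on (snd c ` W) (f \<circ> chart_inv c)"
  shows "smooth_fun A W f"
  unfolding smooth_fun_def
proof
  fix d assume d: "d \<in> A"
  have S: "open (snd d ` (W \<inter> fst d))" by (rule openin_chart_image[OF W(1) d])
  have T: "open (snd c ` W)" using openin_chart_image[OF W(1) c] W(2) by (simp add: Int_absorb2)
  have "smooth_on (snd d ` (W \<inter> fst d)) (\<lambda>x. (f \<circ> chart_inv c) ((snd c \<circ> chart_inv d) x))"
  proof (rule smooth_on_compose[OF S T _ f])
    show "(snd c \<circ> chart_inv d) ` snd d ` (W \<inter> fst d) \<subseteq> snd c ` W"
      using d by auto
    show "smooth_on (snd d ` (W \<inter> fst d)) (snd c \<circ> chart_inv d)"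
      by (rule smooth_on_subset[OF smooth_transition[OF d c]]) (use W(2) in auto)
  qed
  then show "smooth_on (snd d ` (W \<inter> fst d)) (f \<circ> chart_inv d)"
  proof (rule smooth_on_cong[OF S, rotated])
    fix x assume "x \<in> snd d ` (W \<inter> fst d)"
    then obtain q where "q \<in> W" "q \<in> fst d" "x = snd d q" by auto
    then show "(f \<circ> chart_inv c) ((snd c \<circ> chart_inv d) x) = (f \<circ> chart_inv d) x"
      using c d W(2) by auto
  qed
qed

text \<open>In another chart d the component is the Jacobian of the transition map applied to e. In
  a basis its coefficients are derivatives in fixed directions, hence smooth on the image under c;
  composing with the transition from d to c moves them to the image under d.\<close>

lemma smooth_vf_chartI:
  assumes c: "c \<in> A" and W: "openin (manifold_topology A) W" "W \<subseteq> fst c"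
    and e: "smooth_on (snd c ` W) e"
  shows "smooth_vf A W (\<lambda>q. coord_vec A c q (e (snd c q)))"
  unfolding smooth_vf_def
proof (intro conjI ballI)
  fix p assume "p \<in> W"
  then show "coord_vec A c p (e (snd c p)) \<in> tangent_space A p"
    using c W(2) by (intro coord_vec_in) (auto simp: charts_at_def)
next
  fix d assume d: "d \<in> A"
  let ?\<phi> = "snd d \<circ> chart_inv c"
  have S: "open (snd d ` (W \<inter> fst d))" by (rule openin_chart_image[OF W(1) d])
  have "W \<inter> fst d \<inter> fst c = W \<inter> fst d" using W(2) by auto
  then have T: "open (snd c ` (W \<inter> fst d))"
    using openin_chart_image[OF openin_Int[OF W(1) openin_chart[OF d]] c] by simp
  have "smooth_on (snd c ` (W \<inter> fst d)) ?\<phi>"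
    by (rule smooth_on_subset[OF smooth_transition[OF c d]]) (use W(2) in auto)
  then have \<phi>: "smooth_on (snd c ` (W \<inter> fst d)) (\<lambda>z. frechet_derivative ?\<phi> (at z) i)" for i
    by (rule smooth_on_frechet_derivative)
  have e': "smooth_on (snd c ` (W \<inter> fst d)) e"
    by (rule smooth_on_subset[OF e]) auto
  have h: "smooth_on (snd c ` (W \<inter> fst d)) (\<lambda>z. \<Sum>i\<in>Basis. (e z \<bullet> i) *\<^sub>R frechet_derivative ?\<phi> (at z) i)"
    by (intro smooth_on_sum smooth_on_scaleR T \<phi> smooth_on_linear[OF _ bounded_linear_inner_left] e')
  have "smooth_on (snd d ` (W \<inter> fst d)) (\<lambda>x. \<Sum>i\<in>Basis. (e ((snd c \<circ> chart_inv d) x) \<bullet> i) *\<^sub>R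
      frechet_derivative ?\<phi> (at ((snd c \<circ> chart_inv d) x)) i)"
  proof (rule smooth_on_compose[OF S T _ h])
    show "(snd c \<circ> chart_inv d) ` snd d ` (W \<inter> fst d) \<subseteq> snd c ` (W \<inter> fst d)"
      using d by auto
    show "smooth_on (snd d ` (W \<inter> fst d)) (snd c \<circ> chart_inv d)"
      by (rule smooth_on_subset[OF smooth_transition[OF d c]]) (use W(2) in auto)
  qed
  then show "smooth_on (snd d ` (W \<inter> fst d))
      (\<lambda>x. coord_vec A c (chart_inv d x) (e (snd c (chart_inv d x))) d)"
  proof (rule smooth_on_cong[OF S, rotated])
    fix x assume "x \<in> snd d ` (W \<inter> fst d)"
    then obtain q where q: "q \<in> W" "q \<in> fst d" "x = snd d q" by auto
    have ch: "c \<in> charts_at A q" "d \<in> charts_at A q" using c d W(2) q by (auto simp: charts_at_def)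
    have "coord_vec A c q (e (snd c q)) d = (\<Sum>i\<in>Basis. (e (snd c q) \<bullet> i) *\<^sub>R jac c d q i)"
      unfolding coord_vec_apply[OF ch(2)] by (rule linear_basis_expansion[OF linear_jac[OF ch]])
    then show "(\<Sum>i\<in>Basis. (e ((snd c \<circ> chart_inv d) x) \<bullet> i) *\<^sub>R
        frechet_derivative ?\<phi> (at ((snd c \<circ> chart_inv d) x)) i) =
      coord_vec A c (chart_inv d x) (e (snd c (chart_inv d x))) d"
      using q d by (simp add: jac_def)
  qed
qed

lemma smooth_vf_subset:
  assumes "smooth_vf A W Y" "W' \<subseteq> W"
  shows "smooth_vf A W' Y"
  unfolding smooth_vf_def
proof (intro conjI ballI)
  fix d assume "d \<in> A"
  then have "smooth_on (snd d ` (W \<inter> fst d)) (\<lambda>x. Y (chart_inv d x) d)"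
    using assms(1) by (simp add: smooth_vf_def)
  then show "smooth_on (snd d ` (W' \<inter> fst d)) (\<lambda>x. Y (chart_inv d x) d)"
    by (rule smooth_on_subset) (use assms(2) in auto)
qed (use assms in \<open>auto simp: smooth_vf_def\<close>)

section \<open>The charts of the tangent bundle\<close>

lemma fst_tangent_chart: "fst (tangent_chart A c) = {u \<in> tangent_bundle A. fst u \<in> fst c}"
  by (simp add: tangent_chart_def)

lemma snd_tangent_chart: "snd (tangent_chart A c) u = (snd c (fst u), snd u c)"
  by (simp add: tangent_chart_def)

lemma mem_tangent_bundle:
  "u \<in> tangent_bundle A \<longleftrightarrow> fst u \<in> carrier A \<and> snd u \<in> tangent_space A (fst u)"
  by (cases u) (simp add: tangent_bundle_def)

lemma coord_vec_in_tangent_bundle: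
  "c \<in> charts_at A q \<Longrightarrow> (q, coord_vec A c q y) \<in> tangent_bundle A"
  by (auto simp: mem_tangent_bundle coord_vec_in carrier_def charts_at_def)

text \<open>Every y in the model space is the component of a tangent vector, namely of
  \<open>coord_vec\<close>, so the fibre coordinate is unrestricted and openness of overlaps is
  inherited from M.\<close>

lemma tangent_chart_overlap_image:
  assumes c: "c \<in> A" and d: "d \<in> A"
  shows "snd (tangent_chart A c) ` (fst (tangent_chart A c) \<inter> fst (tangent_chart A d)) =
    snd c ` (fst c \<inter> fst d) \<times> UNIV"
proof (intro equalityI subsetI)
  fix z assume "z \<in> snd c ` (fst c \<inter> fst d) \<times> (UNIV :: 'e set)"
  then obtain q y where q: "q \<in> fst c" "q \<in> fst d" "z = (snd c q, y)" by (cases z) auto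
  then have ch: "c \<in> charts_at A q" using c by (simp add: charts_at_def)
  have "z = snd (tangent_chart A c) (q, coord_vec A c q y)"
    using q ch by (simp add: snd_tangent_chart coord_vec_self)
  moreover have "(q, coord_vec A c q y) \<in> fst (tangent_chart A c) \<inter> fst (tangent_chart A d)"
    using coord_vec_in_tangent_bundle[OF ch] q by (simp add: fst_tangent_chart)
  ultimately show "z \<in> snd (tangent_chart A c) ` (fst (tangent_chart A c) \<inter> fst (tangent_chart A d))"
    by blast
qed (auto simp: fst_tangent_chart snd_tangent_chart)

lemma tangent_chart_image: "c \<in> A \<Longrightarrow> snd (tangent_chart A c) ` fst (tangent_chart A c) = snd c ` fst c \<times> UNIV"
  using tangent_chart_overlap_image[of c c] by simp

lemma inj_on_tangent_chart:
  assumes c: "c \<in> A"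
  shows "inj_on (snd (tangent_chart A c)) (fst (tangent_chart A c))"
proof (rule inj_onI)
  fix u v assume u: "u \<in> fst (tangent_chart A c)" and v: "v \<in> fst (tangent_chart A c)"
    and eq: "snd (tangent_chart A c) u = snd (tangent_chart A c) v"
  have f: "fst u = fst v"
    using inj_chart[OF c] eq u v unfolding inj_on_def by (auto simp: fst_tangent_chart snd_tangent_chart)
  moreover have "snd u = snd v"
    using u v eq f c
    by (intro tangent_eqI[of "snd u" "fst u" "snd v" c])
      (auto simp: fst_tangent_chart snd_tangent_chart mem_tangent_bundle charts_at_def)
  ultimately show "u = v" by (simp add: prod_eq_iff)
qed

lemma chart_inv_tangent_chart:
  assumes c: "c \<in> A" and q: "q \<in> fst c"
  shows "chart_inv (tangent_chart A c) (snd c q, y) = (q, coord_vec A c q y)"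
proof -
  have ch: "c \<in> charts_at A q" using c q by (simp add: charts_at_def)
  have "snd (tangent_chart A c) (q, coord_vec A c q y) = (snd c q, y)"
    using ch by (simp add: snd_tangent_chart coord_vec_self)
  moreover have "(q, coord_vec A c q y) \<in> fst (tangent_chart A c)"
    using coord_vec_in_tangent_bundle[OF ch] q by (simp add: fst_tangent_chart)
  ultimately show ?thesis
    unfolding chart_inv_def using inv_into_f_f[OF inj_on_tangent_chart[OF c]] by metis
qed

lemma tangent_transition:
  assumes c: "c \<in> A" and d: "d \<in> A" and x: "x \<in> snd c ` (fst c \<inter> fst d)"
  shows "(snd (tangent_chart A d) \<circ> chart_inv (tangent_chart A c)) (x, y) =
    ((snd d \<circ> chart_inv c) x, frechet_derivative (snd d \<circ> chart_inv c) (at x) y)"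
proof -
  obtain q where q: "q \<in> fst c" "q \<in> fst d" "x = snd c q" using x by auto
  then have "d \<in> charts_at A q" using d by (simp add: charts_at_def)
  then show ?thesis
    using q c by (simp add: chart_inv_tangent_chart snd_tangent_chart coord_vec_apply jac_def)
qed

text \<open>The transition map sends (x, y) to (\<phi> x, D\<phi>(x) y), whose second component is
  linear in y. Differentiating it in x brings in the second derivative of \<phi>.\<close>

lemma tangent_transition_has_derivative:
  assumes c: "c \<in> A" and d: "d \<in> A" and x: "x \<in> snd c ` (fst c \<inter> fst d)"
  shows "((snd (tangent_chart A d) \<circ> chart_inv (tangent_chart A c)) has_derivative
     (\<lambda>w. (frechet_derivative (snd d \<circ> chart_inv c) (at x) (fst w),
       frechet_derivative (\<lambda>x. frechet_derivative (snd d \<circ> chart_inv c) (at x) y) (at x) (fst w) +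
       frechet_derivative (snd d \<circ> chart_inv c) (at x) (snd w)))) (at (x, y))"
proof -
  let ?\<phi> = "snd d \<circ> chart_inv c"
  have sm: "smooth_on (snd c ` (fst c \<inter> fst d)) ?\<phi>" by (rule smooth_transition[OF c d])
  have 1: "((\<lambda>w. ?\<phi> (fst w)) has_derivative (\<lambda>w. frechet_derivative ?\<phi> (at x) (fst w))) (at (x, y))"
  proof (rule has_derivative_compose[where f = fst and g = ?\<phi> and f' = fst])
    show "(?\<phi> has_derivative frechet_derivative ?\<phi> (at x)) (at (fst (x, y)))"
      using smooth_on_differentiable[OF sm x] by (simp add: frechet_derivative_works)
  qed (auto intro!: derivative_eq_intros)
  have 2: "((\<lambda>w. frechet_derivative ?\<phi> (at (fst w)) (snd w)) has_derivative
      (\<lambda>w. frechet_derivative (\<lambda>x. frechet_derivative ?\<phi> (at x) y) (at x) (fst w) +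
       frechet_derivative ?\<phi> (at x) (snd w))) (at (x, y))"
  proof (rule has_derivative_fibrewise_linear[OF open_overlap[OF c d] x])
    show "linear (frechet_derivative ?\<phi> (at z))" if "z \<in> snd c ` (fst c \<inter> fst d)" for z
      using smooth_on_differentiable[OF sm that] by (rule linear_frechet_derivative)
    show "(\<lambda>x. frechet_derivative ?\<phi> (at x) y) differentiable (at x)" for y
      by (rule smooth_on_differentiable[OF smooth_on_frechet_derivative[OF sm] x])
  qed
  from has_derivative_Pair[OF 1 2] show ?thesis
  proof (rule has_derivative_transform_within_open)
    show "open (snd c ` (fst c \<inter> fst d) \<times> (UNIV :: 'e set))"
      using open_overlap[OF c d] by (intro open_Times) auto
    show "(x, y) \<in> snd c ` (fst c \<inter> fst d) \<times> UNIV" using x by simp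
    fix w assume "w \<in> snd c ` (fst c \<inter> fst d) \<times> (UNIV :: 'e set)"
    then show "(?\<phi> (fst w), frechet_derivative ?\<phi> (at (fst w)) (snd w)) =
        (snd (tangent_chart A d) \<circ> chart_inv (tangent_chart A c)) w"
      using tangent_transition[OF c d, of "fst w" "snd w"] by (auto simp del: o_apply)
  qed
qed

sublocale T: diff_atlas "tangent_atlas A"
proof
  fix t s :: "('a \<times> ('a, 'e) tvec, 'e \<times> 'e) chart" and z
  assume "t \<in> tangent_atlas A" "s \<in> tangent_atlas A"
  then obtain c d where cd: "c \<in> A" "d \<in> A" "t = tangent_chart A c" "s = tangent_chart A d"
    by (auto simp: tangent_atlas_def)
  show "inj_on (snd t) (fst t)" using cd inj_on_tangent_chart by simp
  show "open (snd t ` (fst t \<inter> fst s))"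
    using cd open_overlap by (simp add: tangent_chart_overlap_image open_Times)
  assume "z \<in> snd t ` (fst t \<inter> fst s)"
  then have "fst z \<in> snd c ` (fst c \<inter> fst d)"
    using cd by (auto simp: tangent_chart_overlap_image)
  then show "(snd s \<circ> chart_inv t) differentiable (at z)"
    using tangent_transition_has_derivative[OF cd(1,2), of "fst z" "snd z"] cd
    by (auto simp: differentiable_def)
qed

lemma tangent_charts_at:
  assumes "u \<in> tangent_bundle A"
  shows "charts_at (tangent_atlas A) u = tangent_chart A ` charts_at A (fst u)"
  using assms by (auto simp: charts_at_def tangent_atlas_def fst_tangent_chart)

end

section \<open>The Levi-Civita connection in a chart\<close>

locale levi_civita_structure = smooth_atlas_structure A
  for A :: "('a, 'e::euclidean_space) chart set" +
  fixes gM :: "'a \<Rightarrow> ('a, 'e) tvec \<Rightarrow> ('a, 'e) tvec \<Rightarrow> real"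
    and nabla :: "'a \<Rightarrow> ('a, 'e) tvec \<Rightarrow> ('a \<Rightarrow> ('a, 'e) tvec) \<Rightarrow> ('a, 'e) tvec"
  assumes metric: "riemannian_metric A gM"
    and levi_civita: "levi_civita A gM nabla"
begin

lemma connection: "connection A nabla"
  and torsion_free: "torsion_free A nabla"
  and metric_compatible: "metric_compatible A gM nabla"
  using levi_civita by (simp_all add: levi_civita_def)

lemma conn_endomorphism:
  assumes "openin (manifold_topology A) W" "smooth_vf A W Y" "p \<in> W"
  shows "endomorphism_tangent (tangent_space A p) (\<lambda>w. nabla p w Y)"
  by (rule connection[unfolded connection_def, THEN conjunct2, THEN conjunct1, rule_format,
        OF conjI[OF assms(1,2)] assms(3)])

lemma conn_in:
  assumes "openin (manifold_topology A) W" "smooth_vf A W Y" "p \<in> W" "w \<in> tangent_space A p"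
  shows "nabla p w Y \<in> tangent_space A p"
  using conn_endomorphism[OF assms(1-3)] assms(4) unfolding endomorphism_tangent_def by blast

lemma conn_add:
  assumes "openin (manifold_topology A) W" "smooth_vf A W Y" "smooth_vf A W Z" "p \<in> W"
    "w \<in> tangent_space A p"
  shows "nabla p w (\<lambda>q. tadd (Y q) (Z q)) = tadd (nabla p w Y) (nabla p w Z)"
  by (rule connection[unfolded connection_def, THEN conjunct2, THEN conjunct2, THEN conjunct1, rule_format,
        OF conjI[OF assms(1) conjI[OF assms(2,3)]] assms(4,5)])

lemma conn_leibniz:
  assumes "openin (manifold_topology A) W" "smooth_fun A W f" "smooth_vf A W Y" "p \<in> W"
    "w \<in> tangent_space A p"
  shows "nabla p w (\<lambda>q. tscale (f q) (Y q)) =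
    tadd (tscale (dir_deriv A p w f) (Y p)) (tscale (f p) (nabla p w Y))"
  by (rule connection[unfolded connection_def, THEN conjunct2, THEN conjunct2, THEN conjunct2, rule_format,
        OF conjI[OF assms(1) conjI[OF assms(2,3)]] assms(4,5)])

lemma openin_subset_carrier: "openin (manifold_topology A) W \<Longrightarrow> W \<subseteq> carrier A"
  using openin_manifold_topology[OF smooth_atlas] by auto

lemma carrier_chart: "p \<in> carrier A \<Longrightarrow> \<exists>c. c \<in> charts_at A p"
  by (auto simp: carrier_def charts_at_def)

lemma smooth_vf_cong:
  assumes W: "openin (manifold_topology A) W" and Y: "smooth_vf A W Y"
    and eq: "\<And>q. q \<in> W \<Longrightarrow> Y q = Z q"
  shows "smooth_vf A W Z"
  unfolding smooth_vf_def
proof (intro conjI ballI)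
  show "Z p \<in> tangent_space A p" if "p \<in> W" for p
    using Y eq[OF that] that unfolding smooth_vf_def by metis
  fix c assume c: "c \<in> A"
  have "smooth_on (snd c ` (W \<inter> fst c)) (\<lambda>x. Y (chart_inv c x) c)"
    using Y c unfolding smooth_vf_def by blast
  then show "smooth_on (snd c ` (W \<inter> fst c)) (\<lambda>x. Z (chart_inv c x) c)"
    by (rule smooth_on_cong[OF openin_chart_image[OF W c], rotated]) (use c eq in auto)
qed

text \<open>The Leibniz rule is applied to the indicator function of \<open>W\<close>, which is smooth on \<open>W\<close>.\<close>

lemma conn_local:
  assumes W: "openin (manifold_topology A) W" and Y: "smooth_vf A W Y"
    and eq: "\<And>q. q \<in> W \<Longrightarrow> Y q = Z q" and p: "p \<in> W" and w: "w \<in> tangent_space A p"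
  shows "nabla p w Y = nabla p w Z"
proof -
  define f :: "'a \<Rightarrow> real" where "f q = (if q \<in> W then 1 else 0)" for q
  have f: "smooth_fun A W f"
    unfolding smooth_fun_def
  proof
    fix c assume c: "c \<in> A"
    have S: "open (snd c ` (W \<inter> fst c))" by (rule openin_chart_image[OF W c])
    show "smooth_on (snd c ` (W \<inter> fst c)) (f \<circ> chart_inv c)"
      by (rule smooth_on_cong[OF S _ smooth_on_const[OF S, of "1::real"]]) (use c in \<open>auto simp: f_def\<close>)
  qed
  obtain c where c: "c \<in> charts_at A p"
    using carrier_chart openin_subset_carrier[OF W] p by blast
  note cd = charts_atD[OF c]
  have "((\<lambda>x. 1) has_derivative (\<lambda>x. 0)) (at (snd c p))" by (rule has_derivative_const)
  then have "((f \<circ> chart_inv c) has_derivative (\<lambda>x. 0)) (at (snd c p))"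
  proof (rule has_derivative_transform_within_open)
    show "open (snd c ` (W \<inter> fst c))" by (rule openin_chart_image[OF W cd(1)])
  qed (use cd p in \<open>auto simp: f_def\<close>)
  then have "dir_deriv A p w f = 0" using dir_deriv_chart[OF c w] by metis
  then have loc: "nabla p w (\<lambda>q. tscale (f q) (X q)) = nabla p w X" if "smooth_vf A W X" for X
    unfolding conn_leibniz[OF W f that p w] using p by (simp add: f_def tadd_def tscale_def)
  have "(\<lambda>q. tscale (f q) (Y q)) = (\<lambda>q. tscale (f q) (Z q))"
    by (rule ext) (simp add: f_def eq tscale_def)
  with loc[OF Y] loc[OF smooth_vf_cong[OF W Y eq]] show ?thesis by metis
qed

text \<open>The Christoffel symbols of the chart, contracted with the direction \<open>a\<close> and
  the components \<open>y\<close> of the differentiated field.\<close>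

definition Gam :: "('a, 'e) chart \<Rightarrow> 'a \<Rightarrow> 'e \<Rightarrow> 'e \<Rightarrow> 'e" where
  "Gam c p a y = nabla p (coord_vec A c p a) (\<lambda>q. coord_vec A c q y) c"

definition G :: "('a, 'e) chart \<Rightarrow> 'a \<Rightarrow> 'e \<Rightarrow> 'e \<Rightarrow> real" where
  "G c p a b = gM p (coord_vec A c p a) (coord_vec A c p b)"

context
  fixes c W p w
  assumes c: "c \<in> A" and W: "openin (manifold_topology A) W" "W \<subseteq> fst c" and p: "p \<in> W"
    and w: "w \<in> tangent_space A p"
begin

private lemma open_image: "open (snd c ` W)"
  using openin_chart_image[OF W(1) c] W(2) by (simp add: Int_absorb2)

private lemma ch: "q \<in> W \<Longrightarrow> c \<in> charts_at A q"
  using c W(2) by (auto simp: charts_at_def)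

text \<open>Views the covariant derivative as an operator on component functions, so that additivity
  and the Leibniz rule can be applied inside the model space.\<close>

private definition N :: "('e \<Rightarrow> 'e) \<Rightarrow> 'e" where
  "N e = nabla p w (\<lambda>q. coord_vec A c q (e (snd c q))) c"

private lemma N_add:
  assumes e: "smooth_on (snd c ` W) e" and e': "smooth_on (snd c ` W) e'"
  shows "N (\<lambda>x. e x + e' x) = N e + N e'"
proof -
  note vf = smooth_vf_chartI[OF c W]
  have "nabla p w (\<lambda>q. coord_vec A c q (e (snd c q) + e' (snd c q))) =
     nabla p w (\<lambda>q. tadd (coord_vec A c q (e (snd c q))) (coord_vec A c q (e' (snd c q))))"
    by (rule conn_local[OF W(1) _ _ p w])
      (use vf[OF smooth_on_add[OF open_image e e']] in \<open>auto simp: coord_vec_add ch\<close>)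
  also have "\<dots> = tadd (nabla p w (\<lambda>q. coord_vec A c q (e (snd c q))))
      (nabla p w (\<lambda>q. coord_vec A c q (e' (snd c q))))"
    by (rule conn_add[OF W(1) vf[OF e] vf[OF e'] p w])
  finally show ?thesis by (simp add: N_def tadd_def)
qed

private lemma N_scale:
  assumes f: "smooth_on (snd c ` W) f" and e: "smooth_on (snd c ` W) e"
  shows "N (\<lambda>x. f x *\<^sub>R e x) =
    frechet_derivative f (at (snd c p)) (w c) *\<^sub>R e (snd c p) + f (snd c p) *\<^sub>R N e"
proof -
  note vf = smooth_vf_chartI[OF c W]
  let ?f = "\<lambda>q. f (snd c q)"
  have cinv: "f x = (?f \<circ> chart_inv c) x" if "x \<in> snd c ` W" for x
    using that c W(2) by auto
  have "smooth_on (snd c ` W) (?f \<circ> chart_inv c)"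
    by (rule smooth_on_cong[OF open_image cinv f])
  then have f': "smooth_fun A W ?f" by (rule smooth_fun_chartI[OF c W])
  have xp: "snd c p \<in> snd c ` W" using p by simp
  have "(f has_derivative frechet_derivative f (at (snd c p))) (at (snd c p))"
    using smooth_on_differentiable[OF f xp] by (simp add: frechet_derivative_works)
  then have "((?f \<circ> chart_inv c) has_derivative frechet_derivative f (at (snd c p))) (at (snd c p))"
    by (rule has_derivative_transform_within_open[OF _ open_image xp cinv])
  then have dd: "dir_deriv A p w ?f = frechet_derivative f (at (snd c p)) (w c)"
    by (rule dir_deriv_chart[OF ch[OF p] w])
  have "nabla p w (\<lambda>q. coord_vec A c q (f (snd c q) *\<^sub>R e (snd c q))) =
     nabla p w (\<lambda>q. tscale (?f q) (coord_vec A c q (e (snd c q))))"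
    by (rule conn_local[OF W(1) _ _ p w])
      (use vf[OF smooth_on_scaleR[OF open_image f e]] in \<open>auto simp: coord_vec_scale ch\<close>)
  also have "\<dots> = tadd (tscale (dir_deriv A p w ?f) (coord_vec A c p (e (snd c p))))
      (tscale (?f p) (nabla p w (\<lambda>q. coord_vec A c q (e (snd c q)))))"
    by (rule conn_leibniz[OF W(1) f' vf[OF e] p w])
  finally show ?thesis by (simp add: N_def tadd_def tscale_def dd coord_vec_self ch p)
qed

private lemma N_const: "N (\<lambda>x. y) = Gam c p (w c) y"
  by (simp add: N_def Gam_def coord_vec_component[OF w ch[OF p]])

lemma linear_Gam_component: "linear (Gam c p (w c))"
proof
  show "Gam c p (w c) (y + z) = Gam c p (w c) y + Gam c p (w c) z" for y z
    using N_add[OF smooth_on_const smooth_on_const, OF open_image open_image] by (simp add: N_const)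
  show "Gam c p (w c) (r *\<^sub>R y) = r *\<^sub>R Gam c p (w c) y" for r y
    using N_scale[OF smooth_on_const smooth_on_const, OF open_image open_image, of r y]
    by (simp add: N_const)
qed

text \<open>The classical coordinate formula. A basis expansion writes the field as a sum of
  functions times constant-component fields; the Leibniz rule differentiates the coefficient
  functions, and linearity of \<open>Gam\<close> reassembles the remaining terms.\<close>

lemma conn_chart_vf:
  assumes e: "smooth_on (snd c ` W) e"
  shows "nabla p w (\<lambda>q. coord_vec A c q (e (snd c q))) c =
    frechet_derivative e (at (snd c p)) (w c) + Gam c p (w c) (e (snd c p))"
proof -
  let ?x = "snd c p"
  have xp: "?x \<in> snd c ` W" using p by simp
  have ei: "smooth_on (snd c ` W) (\<lambda>x. e x \<bullet> i)" for i
    by (rule smooth_on_linear[OF open_image bounded_linear_inner_left e])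
  have De: "(e has_derivative frechet_derivative e (at ?x)) (at ?x)"
    using smooth_on_differentiable[OF e xp] by (simp add: frechet_derivative_works)
  have Dei: "frechet_derivative (\<lambda>x. e x \<bullet> i) (at ?x) = (\<lambda>v. frechet_derivative e (at ?x) v \<bullet> i)" for i
    using frechet_derivative_at[OF bounded_linear.has_derivative[OF bounded_linear_inner_left De]] by simp
  have single: "N (\<lambda>x. (e x \<bullet> i) *\<^sub>R i) =
     (frechet_derivative e (at ?x) (w c) \<bullet> i) *\<^sub>R i + (e ?x \<bullet> i) *\<^sub>R Gam c p (w c) i" for i
    using N_scale[OF ei smooth_on_const[OF open_image]] by (simp add: N_const Dei)
  \<comment> \<open>\<open>N_add\<close> is binary, so the basis expansion is handled by induction
    over a finite index set.\<close>
  have sum: "N (\<lambda>x. \<Sum>i\<in>F. (e x \<bullet> i) *\<^sub>R i) = (\<Sum>i\<in>F. (frechet_derivative e (at ?x) (w c) \<bullet> i) *\<^sub>R i +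
      (e ?x \<bullet> i) *\<^sub>R Gam c p (w c) i)" if "finite F" for F
    using that
  proof (induction F rule: finite_induct)
    case empty
    then show ?case using linear_0[OF linear_Gam_component] by (simp add: N_const)
  next
    case (insert i F)
    have "N (\<lambda>x. (e x \<bullet> i) *\<^sub>R i + (\<Sum>i\<in>F. (e x \<bullet> i) *\<^sub>R i)) =
        N (\<lambda>x. (e x \<bullet> i) *\<^sub>R i) + N (\<lambda>x. \<Sum>i\<in>F. (e x \<bullet> i) *\<^sub>R i)"
      by (intro N_add smooth_on_sum smooth_on_scaleR open_image ei smooth_on_const)
    then show ?case using insert by (simp add: single)
  qed
  have "N e = N (\<lambda>x. \<Sum>i\<in>Basis. (e x \<bullet> i) *\<^sub>R i)"
    by (simp only: euclidean_representation)
  also have "\<dots> = frechet_derivative e (at ?x) (w c) + (\<Sum>i\<in>Basis. (e ?x \<bullet> i) *\<^sub>R Gam c p (w c) i)"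
    unfolding sum[OF finite_Basis] by (simp only: sum.distrib euclidean_representation)
  also have "(\<Sum>i\<in>Basis. (e ?x \<bullet> i) *\<^sub>R Gam c p (w c) i) = Gam c p (w c) (e ?x)"
    by (rule linear_basis_expansion[OF linear_Gam_component, symmetric])
  finally show ?thesis by (simp add: N_def)
qed

end

lemma smooth_coord_vf:
  assumes "c \<in> A"
  shows "smooth_vf A (fst c) (\<lambda>q. coord_vec A c q y)"
  using smooth_vf_chartI[OF assms openin_chart[OF assms] subset_refl smooth_on_const[OF open_chart[OF assms]]] .

lemma linear_Gam_left:
  assumes c: "c \<in> charts_at A p"
  shows "linear (\<lambda>a. Gam c p a y)"
proof -
  note cd = charts_atD[OF c]
  have e: "endomorphism_tangent (tangent_space A p) (\<lambda>w. nabla p w (\<lambda>q. coord_vec A c q y))"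
    by (rule conn_endomorphism[OF openin_chart[OF cd(1)] smooth_coord_vf[OF cd(1)] cd(2)])
  show ?thesis
  proof
    fix a b
    have "nabla p (tadd (coord_vec A c p a) (coord_vec A c p b)) (\<lambda>q. coord_vec A c q y) =
      tadd (nabla p (coord_vec A c p a) (\<lambda>q. coord_vec A c q y)) (nabla p (coord_vec A c p b) (\<lambda>q. coord_vec A c q y))"
      using e coord_vec_in[OF c] unfolding endomorphism_tangent_def by blast
    then show "Gam c p (a + b) y = Gam c p a y + Gam c p b y"
      by (simp add: Gam_def coord_vec_add[OF c]) (simp add: tadd_def)
  next
    fix r a
    have "nabla p (tscale r (coord_vec A c p a)) (\<lambda>q. coord_vec A c q y) =
      tscale r (nabla p (coord_vec A c p a) (\<lambda>q. coord_vec A c q y))"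
      using e coord_vec_in[OF c] unfolding endomorphism_tangent_def by blast
    then show "Gam c p (r *\<^sub>R a) y = r *\<^sub>R Gam c p a y"
      by (simp add: Gam_def coord_vec_scale[OF c]) (simp add: tscale_def)
  qed
qed

text \<open>Vanishing torsion applied to two coordinate fields, whose Lie bracket is zero.\<close>

lemma Gam_sym:
  assumes c: "c \<in> charts_at A p"
  shows "Gam c p a b = Gam c p b a"
proof -
  note cd = charts_atD[OF c]
  \<comment> \<open>The component \<open>coord_vec A c q y c\<close> equals y only for q in the
    domain of c, so constancy is used on the open image of the chart.\<close>
  have D0: "chart_deriv c p v (\<lambda>q. coord_vec A c q y c) = 0" for y v
  proof -
    have "((\<lambda>x. y) has_derivative (\<lambda>x. 0)) (at (snd c p))" by (rule has_derivative_const)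
    then have "(((\<lambda>q. coord_vec A c q y c) \<circ> chart_inv c) has_derivative (\<lambda>x. 0)) (at (snd c p))"
      by (rule has_derivative_transform_within_open[OF _ open_chart[OF cd(1)]])
        (use cd in \<open>auto simp: coord_vec_self charts_at_def\<close>)
    from frechet_derivative_at[OF this] show ?thesis
      by (simp add: chart_deriv_def flip: fun_eq_iff) metis
  qed
  have "nabla p (coord_vec A c p a) (\<lambda>q. coord_vec A c q b) =
     tadd (nabla p (coord_vec A c p b) (\<lambda>q. coord_vec A c q a))
       (lie_bracket A (\<lambda>q. coord_vec A c q a) (\<lambda>q. coord_vec A c q b) p)"
    by (rule torsion_free[unfolded torsion_free_def, rule_format, OF conjI[OF openin_chart[OF cd(1)]
          conjI[OF smooth_coord_vf[OF cd(1)] smooth_coord_vf[OF cd(1)]]] cd(2)])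
  then have "Gam c p a b = Gam c p b a +
      lie_bracket A (\<lambda>q. coord_vec A c q a) (\<lambda>q. coord_vec A c q b) p c"
    by (simp add: Gam_def tadd_def)
  then show ?thesis by (simp add: lie_bracket_def c D0)
qed

lemma symmetric_gM: "p \<in> carrier A \<Longrightarrow> symmetric_bilinear_tangent (tangent_space A p) (gM p)"
  using metric unfolding riemannian_metric_def by blast

lemma in_carrier: "c \<in> charts_at A p \<Longrightarrow> p \<in> carrier A"
  by (auto simp: charts_at_def carrier_def)

lemma G_sym: "c \<in> charts_at A p \<Longrightarrow> G c p a b = G c p b a"
  using symmetric_gM[OF in_carrier] coord_vec_in unfolding symmetric_bilinear_tangent_def G_def by blast

lemma linear_G_right:
  assumes c: "c \<in> charts_at A p"
  shows "linear (G c p a)"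
proof -
  have e: "linear_tangent (tangent_space A p) (gM p (coord_vec A c p a))"
    using symmetric_gM[OF in_carrier[OF c]] coord_vec_in[OF c] unfolding symmetric_bilinear_tangent_def by blast
  show ?thesis
  proof
    show "G c p a (b + d) = G c p a b + G c p a d" for b d
      using e coord_vec_in[OF c] unfolding linear_tangent_def G_def coord_vec_add[OF c] by blast
    show "G c p a (r *\<^sub>R b) = r *\<^sub>R G c p a b" for r b
      using e coord_vec_in[OF c] unfolding linear_tangent_def G_def coord_vec_scale[OF c] by simp
  qed
qed

lemma linear_G_left:
  assumes c: "c \<in> charts_at A p"
  shows "linear (\<lambda>a. G c p a b)"
  using linear_G_right[OF c, of b] by (simp only: G_sym[OF c, of _ b])

lemma G_pos:
  assumes c: "c \<in> charts_at A p" and "a \<noteq> 0"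
  shows "G c p a a > 0"
proof -
  have "coord_vec A c p a \<noteq> tzero"
    using coord_vec_self[OF c, of a] assms(2) by (auto simp: tzero_def)
  then show ?thesis
    using metric in_carrier[OF c] coord_vec_in[OF c] unfolding riemannian_metric_def G_def by blast
qed

lemma smooth_G:
  assumes "c \<in> A"
  shows "smooth_on (snd c ` fst c) (\<lambda>x. G c (chart_inv c x) a b)"
proof -
  have "smooth_fun A (fst c) (\<lambda>p. gM p (coord_vec A c p a) (coord_vec A c p b))"
    using metric assms unfolding riemannian_metric_def by blast
  then show ?thesis using assms unfolding smooth_fun_def by (auto simp: G_def o_def)
qed

text \<open>Metric compatibility for two coordinate fields. In \<open>form_eq\<close> this trades
  all derivatives of the metric coefficients for Christoffel terms.\<close>

lemma G_metric:
  assumes c: "c \<in> charts_at A p"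
  shows "frechet_derivative (\<lambda>x. G c (chart_inv c x) y z) (at (snd c p)) a =
    G c p (Gam c p a y) z + G c p y (Gam c p a z)"
proof -
  note cd = charts_atD[OF c]
  let ?Y = "\<lambda>y q. coord_vec A c q y"
  have n: "nabla p (?Y a p) (?Y y) = ?Y (Gam c p a y) p" for y
    unfolding Gam_def
    by (rule coord_vec_component[symmetric, OF conn_in[OF openin_chart[OF cd(1)] smooth_coord_vf[OF cd(1)] cd(2) coord_vec_in[OF c]] c])
  have "dir_deriv A p (?Y a p) (\<lambda>q. gM q (?Y y q) (?Y z q)) =
     gM p (nabla p (?Y a p) (?Y y)) (?Y z p) + gM p (?Y y p) (nabla p (?Y a p) (?Y z))"
    by (rule metric_compatible[unfolded metric_compatible_def, rule_format, OF conjI[OF openin_chart[OF cd(1)]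
          conjI[OF smooth_coord_vf[OF cd(1)] smooth_coord_vf[OF cd(1)]]] cd(2) coord_vec_in[OF c]])
  also have "\<dots> = G c p (Gam c p a y) z + G c p y (Gam c p a z)"
    unfolding n by (simp add: G_def)
  finally have 1: "dir_deriv A p (?Y a p) (\<lambda>q. gM q (?Y y q) (?Y z q)) =
      G c p (Gam c p a y) z + G c p y (Gam c p a z)" .
  have "((\<lambda>x. G c (chart_inv c x) y z) has_derivative
      frechet_derivative (\<lambda>x. G c (chart_inv c x) y z) (at (snd c p))) (at (snd c p))"
    using smooth_on_differentiable[OF smooth_G[OF cd(1)]] cd by (simp add: frechet_derivative_works)
  then have "(((\<lambda>q. gM q (?Y y q) (?Y z q)) \<circ> chart_inv c) has_derivative
      frechet_derivative (\<lambda>x. G c (chart_inv c x) y z) (at (snd c p))) (at (snd c p))"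
    by (simp add: G_def o_def)
  from dir_deriv_chart[OF c coord_vec_in[OF c] this, of a] 1 show ?thesis
    by (simp add: coord_vec_self[OF c])
qed

text \<open>Near p the field coincides with the one rebuilt from its component function in c, and by
  \<open>conn_local\<close> the connection sees no more than that.\<close>

lemma conn_chart:
  assumes W: "openin (manifold_topology A) W" and Y: "smooth_vf A W Y" and p: "p \<in> W"
    and w: "w \<in> tangent_space A p" and c: "c \<in> charts_at A p"
  shows "nabla p w Y c =
    frechet_derivative (\<lambda>x. Y (chart_inv c x) c) (at (snd c p)) (w c) + Gam c p (w c) (Y p c)"
proof -
  note cd = charts_atD[OF c]
  let ?e = "\<lambda>x. Y (chart_inv c x) c"
  have W': "openin (manifold_topology A) (W \<inter> fst c)" "W \<inter> fst c \<subseteq> fst c" "p \<in> W \<inter> fst c"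
    using W openin_chart[OF cd(1)] p cd by (auto intro: openin_Int)
  have e: "smooth_on (snd c ` (W \<inter> fst c)) ?e"
    using Y cd(1) unfolding smooth_vf_def by blast
  have "nabla p w Y = nabla p w (\<lambda>q. coord_vec A c q (?e (snd c q)))"
  proof (rule conn_local[OF W'(1) smooth_vf_subset[OF Y Int_lower1] _ W'(3) w])
    fix q assume q: "q \<in> W \<inter> fst c"
    then have "Y q \<in> tangent_space A q" using Y unfolding smooth_vf_def by blast
    then show "Y q = coord_vec A c q (?e (snd c q))"
      using q cd(1) by (simp add: coord_vec_component charts_at_def)
  qed
  then show ?thesis
    using conn_chart_vf[OF cd(1) W' w e] cd by simp
qed

section \<open>Lifts in a chart\<close>

lemma tangent_bundleD:
  "u \<in> tangent_bundle A \<Longrightarrow> snd u \<in> tangent_space A (fst u)"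
  by (simp add: mem_tangent_bundle)

lemma tangent_chart_at:
  "u \<in> tangent_bundle A \<Longrightarrow> c \<in> charts_at A (fst u) \<Longrightarrow>
    tangent_chart A c \<in> charts_at (tangent_atlas A) u"
  by (simp add: tangent_charts_at)

text \<open>Being parallel in direction w forces the derivative of the components along w to be
  minus the Christoffel term, so dY(w) depends on Y only through its value at p. This makes the
  horizontal lift well defined.\<close>

lemma section_differential:
  assumes W: "openin (manifold_topology A) W" and Y: "smooth_vf A W Y" and p: "p \<in> W"
    and w: "w \<in> tangent_space A p" and parallel: "nabla p w Y = tzero"
  shows "differential A (tangent_atlas A) (\<lambda>q. (q, Y q)) p w \<in> tangent_space (tangent_atlas A) (p, Y p)"
    and "d \<in> charts_at A p \<Longrightarrow> differential A (tangent_atlas A) (\<lambda>q. (q, Y q)) p w (tangent_chart A d) =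
      (w d, - Gam d p (w d) (Y p d))"
proof -
  let ?F = "\<lambda>q. (q, Y q)"
  have u: "?F q \<in> tangent_bundle A" if "q \<in> W" for q
    using openin_subset_carrier[OF W] Y that unfolding smooth_vf_def by (auto simp: mem_tangent_bundle)
  have Dd: "((\<lambda>x. Y (chart_inv d x) d) has_derivative
      frechet_derivative (\<lambda>x. Y (chart_inv d x) d) (at (snd d p))) (at (snd d p))"
    if d: "d \<in> charts_at A p" for d
  proof -
    have "smooth_on (snd d ` (W \<inter> fst d)) (\<lambda>x. Y (chart_inv d x) d)"
      using Y charts_atD(1)[OF d] unfolding smooth_vf_def by blast
    then show ?thesis
      using smooth_on_differentiable[of "snd d ` (W \<inter> fst d)" _ "snd d p"] p charts_atD(2)[OF d]
      by (simp add: frechet_derivative_works)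
  qed
  have Fd: "((\<lambda>x. snd (tangent_chart A d) (?F (chart_inv c x))) has_derivative
      (\<lambda>a. (jac c d p a, (frechet_derivative (\<lambda>x. Y (chart_inv d x) d) (at (snd d p)) \<circ> jac c d p) a)))
        (at (snd c p))" if c: "c \<in> charts_at A p" and d: "d \<in> charts_at A p" for c d
  proof -
    have 1: "(((\<lambda>q. Y q d) \<circ> chart_inv c) has_derivative
        (frechet_derivative (\<lambda>x. Y (chart_inv d x) d) (at (snd d p)) \<circ> jac c d p)) (at (snd c p))"
      by (rule has_derivative_change_chart[OF c d]) (use Dd[OF d] in \<open>simp add: o_def\<close>)
    from has_derivative_Pair[OF has_derivative_jac[OF c d] 1] show ?thesis
      by (simp add: snd_tangent_chart o_def)
  qed
  obtain c where c: "c \<in> charts_at A p"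
    using carrier_chart openin_subset_carrier[OF W] p by blast
  note cd = charts_atD[OF c]
  have ch: "charts_at (tangent_atlas A) (?F p) = tangent_chart A ` charts_at A p"
    using tangent_charts_at[OF u[OF p]] by simp
  show "differential A (tangent_atlas A) ?F p w \<in> tangent_space (tangent_atlas A) (p, Y p)"
  proof (rule differential_in[OF T.diff_atlas_axioms c w])
    fix t assume "t \<in> charts_at (tangent_atlas A) (?F p)"
    then obtain d where d: "d \<in> charts_at A p" "t = tangent_chart A d" using ch by auto
    have dA: "d \<in> A" "p \<in> fst d" using charts_atD[OF d(1)] .
    \<comment> \<open>Over W, the section lies in the domain of the bundle chart exactly above the
      domain of d.\<close>
    have eq: "{q. q \<in> W \<and> ?F q \<in> fst t} = W \<inter> fst d"
      using u d by (auto simp: fst_tangent_chart)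
    have op: "openin (manifold_topology A) (W \<inter> fst d)"
      using W openin_chart[OF dA(1)] by (rule openin_Int)
    show "open (snd c ` ({q. q \<in> W \<and> ?F q \<in> fst t} \<inter> fst c))"
      unfolding eq by (rule openin_chart_image[OF op cd(1)])
    show "snd c p \<in> snd c ` ({q. q \<in> W \<and> ?F q \<in> fst t} \<inter> fst c)"
      unfolding eq using p dA cd by auto
    show "?F (chart_inv c x) \<in> fst t" if "x \<in> snd c ` ({q. q \<in> W \<and> ?F q \<in> fst t} \<inter> fst c)" for x
      using that cd by auto
    show "((\<lambda>x. snd t (?F (chart_inv c x))) has_derivative
        frechet_derivative (\<lambda>x. snd t (?F (chart_inv c x))) (at (snd c p))) (at (snd c p))"
      unfolding frechet_derivative_works[symmetric] differentiable_def d(2)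
      by (rule exI) (rule Fd[OF c d(1)])
  qed
  assume d: "d \<in> charts_at A p"
  have "tangent_chart A d \<in> charts_at (tangent_atlas A) (?F p)" using ch d by simp
  from differential_apply[OF d w this Fd[OF d d]]
  have "differential A (tangent_atlas A) ?F p w (tangent_chart A d) =
      (w d, frechet_derivative (\<lambda>x. Y (chart_inv d x) d) (at (snd d p)) (w d))"
    by (simp add: jac_self[OF d])
  moreover have "frechet_derivative (\<lambda>x. Y (chart_inv d x) d) (at (snd d p)) (w d) + Gam d p (w d) (Y p d) = 0"
    using conn_chart[OF W Y p w d] parallel by (simp add: tzero_def)
  ultimately show "differential A (tangent_atlas A) ?F p w (tangent_chart A d) =
      (w d, - Gam d p (w d) (Y p d))"
    by (simp add: eq_neg_iff_add_eq_0)
qed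

text \<open>In bundle charts the projection is the linear map \<open>fst\<close>, hence its own
  derivative.\<close>

lemma projection_differential:
  assumes u: "u \<in> tangent_bundle A" and \<xi>: "\<xi> \<in> tangent_space (tangent_atlas A) u"
    and d: "d \<in> charts_at A (fst u)"
  shows "differential (tangent_atlas A) A fst u \<xi> d = fst (\<xi> (tangent_chart A d))"
proof -
  note dd = charts_atD[OF d]
  have "(fst has_derivative fst) (at (snd (tangent_chart A d) u))"
    by (auto intro!: derivative_eq_intros)
  then have "((\<lambda>z. snd d (fst (chart_inv (tangent_chart A d) z))) has_derivative fst)
      (at (snd (tangent_chart A d) u))"
  proof (rule has_derivative_transform_within_open)
    show "open (snd (tangent_chart A d) ` fst (tangent_chart A d))"
      by (rule T.open_chart) (use dd in \<open>simp add: tangent_atlas_def\<close>)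
    show "snd (tangent_chart A d) u \<in> snd (tangent_chart A d) ` fst (tangent_chart A d)"
      using u dd by (intro imageI) (simp add: fst_tangent_chart)
    fix z assume "z \<in> snd (tangent_chart A d) ` fst (tangent_chart A d)"
    then obtain q y where "q \<in> fst d" "z = (snd d q, y)"
      unfolding tangent_chart_image[OF dd(1)] by auto
    then show "fst z = snd d (fst (chart_inv (tangent_chart A d) z))"
      using dd(1) by (simp add: chart_inv_tangent_chart)
  qed
  from T.differential_apply[OF tangent_chart_at[OF u d] \<xi>, of d A fst, OF d this]
  show ?thesis .
qed

text \<open>Value and parallelism at a single point prescribe only first-order data there, so a
  field with affine components suffices.\<close>

lemma horizontal_field:
  assumes u: "u \<in> tangent_bundle A" and w: "w \<in> tangent_space A (fst u)"
  obtains W Y where "openin (manifold_topology A) W" "fst u \<in> W" "smooth_vf A W Y"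
    "Y (fst u) = snd u" "nabla (fst u) w Y = tzero"
proof -
  let ?p = "fst u"
  obtain c where c: "c \<in> charts_at A ?p"
    using carrier_chart u unfolding mem_tangent_bundle by blast
  note cd = charts_atD[OF c]
  let ?x = "snd c ?p"
  let ?y = "snd u c"
  \<comment> \<open>The linear part cancels the Christoffel term at the base point; the constant
    \<open>?y\<close> in \<open>e\<close> below supplies the prescribed value.\<close>
  define L where "L = (\<lambda>a. - Gam c ?p a ?y)"
  have linL: "linear L" unfolding L_def using linear_Gam_left[OF c]
    by (intro linear_compose_neg)
  then have L: "bounded_linear L" by (simp add: linear_conv_bounded_linear)
  define e where "e = (\<lambda>x. L (x + (- ?x)) + ?y)"
  have O: "open (snd c ` fst c)" by (rule open_chart[OF cd(1)])
  have e: "smooth_on (snd c ` fst c) e"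
    unfolding e_def by (intro smooth_on_add smooth_on_linear[OF _ L] smooth_on_ident smooth_on_const O)
  have "(e has_derivative L) (at ?x)"
    unfolding e_def by (auto intro!: derivative_eq_intros bounded_linear.has_derivative[OF L])
  then have De: "frechet_derivative e (at ?x) = L" by (metis frechet_derivative_at)
  have ex: "e ?x = ?y" using linear_0[OF linL] by (simp add: e_def)
  let ?Y = "\<lambda>q. coord_vec A c q (e (snd c q))"
  have Y: "smooth_vf A (fst c) ?Y"
    by (rule smooth_vf_chartI[OF cd(1) openin_chart[OF cd(1)] subset_refl e])
  have "nabla ?p w ?Y c = 0"
    using conn_chart_vf[OF cd(1) openin_chart[OF cd(1)] subset_refl cd(2) w e] by (simp add: De ex L_def)
  then have "nabla ?p w ?Y = tzero"
    using conn_in[OF openin_chart[OF cd(1)] Y cd(2) w] tzero_in c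
    by (intro tangent_eqI[where c = c and p = ?p]) (auto simp: tzero_def)
  moreover have "?Y ?p = snd u"
    using coord_vec_component[OF tangent_bundleD[OF u] c] by (simp add: ex)
  ultimately show thesis
    using that[OF openin_chart[OF cd(1)] cd(2) Y] by blast
qed

text \<open>The definite description needs existence and uniqueness. The projection fixes the base
  component to be that of w, and \<open>section_differential\<close> then fixes the fibre component;
  \<open>horizontal_field\<close> provides a candidate.\<close>

lemma horizontal_lift:
  assumes u: "u \<in> tangent_bundle A" and w: "w \<in> tangent_space A (fst u)" and c: "c \<in> charts_at A (fst u)"
  shows "horizontal_lift A nabla u w =
    coord_vec (tangent_atlas A) (tangent_chart A c) u (w c, - Gam c (fst u) (w c) (snd u c))"
proof -
  let ?p = "fst u"
  have horizontal: "\<exists>w'\<in>tangent_space A ?p. \<xi> \<in> tangent_space (tangent_atlas A) u \<and>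
      (\<forall>d\<in>charts_at A ?p. \<xi> (tangent_chart A d) = (w' d, - Gam d ?p (w' d) (snd u d)))"
    if \<xi>: "\<xi> \<in> horizontal_space A nabla u" for \<xi>
  proof -
    obtain w' W Y where h: "\<xi> = differential A (tangent_atlas A) (\<lambda>q. (q, Y q)) ?p w'"
      "w' \<in> tangent_space A ?p" "openin (manifold_topology A) W" "?p \<in> W"
      "smooth_vf A W Y" "Y ?p = snd u" "nabla ?p w' Y = tzero"
      using \<xi> unfolding horizontal_space_def by blast
    show ?thesis
      using section_differential[OF h(3,5,4,2,7)] h(1,2,6) by auto
  qed
  have unique: "\<xi> = coord_vec (tangent_atlas A) (tangent_chart A c) u (w c, - Gam c ?p (w c) (snd u c))"
    if \<xi>: "\<xi> \<in> horizontal_space A nabla u" "differential (tangent_atlas A) A fst u \<xi> = w" for \<xi>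
  proof -
    obtain w' where w': "\<xi> \<in> tangent_space (tangent_atlas A) u"
      "\<xi> (tangent_chart A c) = (w' c, - Gam c ?p (w' c) (snd u c))"
      using horizontal[OF \<xi>(1)] c by blast
    have "w c = w' c"
      using projection_differential[OF u w'(1) c] \<xi>(2) w'(2) by simp
    then show ?thesis
      using T.coord_vec_component[OF w'(1) tangent_chart_at[OF u c]] w'(2) by simp
  qed
  obtain W Y where h: "openin (manifold_topology A) W" "?p \<in> W" "smooth_vf A W Y"
    "Y ?p = snd u" "nabla ?p w Y = tzero"
    using horizontal_field[OF u w] .
  let ?\<xi> = "differential A (tangent_atlas A) (\<lambda>q. (q, Y q)) ?p w"
  have H: "?\<xi> \<in> horizontal_space A nabla u"
    unfolding horizontal_space_def mem_Collect_eq by (intro exI conjI) (rule refl w h)+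
  have T: "?\<xi> \<in> tangent_space (tangent_atlas A) u"
    using section_differential(1)[OF h(1,3,2) w h(5)] h(4) by simp
  have "differential (tangent_atlas A) A fst u ?\<xi> = w"
  proof
    fix d
    show "differential (tangent_atlas A) A fst u ?\<xi> d = w d"
    proof (cases "d \<in> charts_at A ?p")
      case True
      then show ?thesis
        using projection_differential[OF u T True] section_differential(2)[OF h(1,3,2) w h(5) True] by simp
    next
      case False
      then show ?thesis
        using tangent_outside[OF w False] by (simp add: differential_def)
    qed
  qed
  note dpi = this
  have "horizontal_lift A nabla u w = ?\<xi>"
    unfolding horizontal_lift_def
  proof (rule the_equality)
    show "?\<xi> \<in> horizontal_space A nabla u \<and> differential (tangent_atlas A) A fst u ?\<xi> = w"
      by (rule conjI[OF H dpi])
    show "\<xi> = ?\<xi>"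
      if "\<xi> \<in> horizontal_space A nabla u \<and> differential (tangent_atlas A) A fst u \<xi> = w" for \<xi>
      unfolding unique[OF conjunct1[OF that] conjunct2[OF that]] by (rule unique[OF H dpi, symmetric])
  qed
  then show ?thesis unfolding unique[OF H dpi] .
qed

text \<open>The curve is affine in the fibre over a fixed base point, so its velocity has components
  (0, w d) in each bundle chart. Bundle transitions respect this because their second-derivative
  term acts on the base component, which is 0.\<close>

lemma vertical_lift:
  assumes u: "u \<in> tangent_bundle A" and w: "w \<in> tangent_space A (fst u)" and c: "c \<in> charts_at A (fst u)"
  shows "vertical_lift A u w = coord_vec (tangent_atlas A) (tangent_chart A c) u (0, w c)"
proof
  fix t
  let ?p = "fst u"
  have u0: "(?p, tadd (snd u) (tscale 0 w)) = u"
    by (simp add: tadd_def tscale_def)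
  show "vertical_lift A u w t = coord_vec (tangent_atlas A) (tangent_chart A c) u (0, w c) t"
  proof (cases "t \<in> charts_at (tangent_atlas A) u")
    case False
    then show ?thesis
      unfolding vertical_lift_def velocity_def coord_vec_def u0 by simp
  next
    case True
    then obtain d where d: "d \<in> charts_at A ?p" "t = tangent_chart A d"
      using tangent_charts_at[OF u] by auto
    have "((\<lambda>s. (snd d ?p, snd u d + s *\<^sub>R w d)) has_vector_derivative (0, w d)) (at 0)"
      by (auto intro!: derivative_eq_intros has_vector_derivative_Pair)
    then have "((snd t \<circ> (\<lambda>s. (?p, tadd (snd u) (tscale s w)))) has_vector_derivative (0, w d)) (at 0)"
      by (simp add: d snd_tangent_chart tadd_def tscale_def o_def)
    then have "vector_derivative (snd t \<circ> (\<lambda>s. (?p, tadd (snd u) (tscale s w)))) (at 0) = (0, w d)"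
      by (rule vector_derivative_at)
    then have 1: "vertical_lift A u w t = (0, w d)"
      unfolding vertical_lift_def velocity_def u0 using True by simp
    note cA = charts_atD[OF c] charts_atD[OF d(1)]
    have x: "snd c ?p \<in> snd c ` (fst c \<inter> fst d)" using cA by simp
    have lin: "linear (frechet_derivative (\<lambda>x. frechet_derivative (snd d \<circ> chart_inv c) (at x) (snd u c)) (at (snd c ?p)))"
      by (rule linear_frechet_derivative[OF smooth_on_differentiable[OF smooth_on_frechet_derivative[OF
            smooth_transition[OF cA(1,3)]] x]])
    have "T.jac (tangent_chart A c) t u (0, w c) = (jac c d ?p 0, 0 + jac c d ?p (w c))"
      unfolding T.jac_def d(2) snd_tangent_chart
        frechet_derivative_at[OF tangent_transition_has_derivative[OF cA(1,3) x, of "snd u c"], symmetric]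
      by (simp add: linear_0[OF lin] jac_def)
    then have "T.jac (tangent_chart A c) t u (0, w c) = (0, w d)"
      using linear_0[OF linear_jac[OF c d(1)]] tangent_jac[OF w c d(1)] by simp
    then show ?thesis using 1 T.coord_vec_apply[OF True] by simp
  qed
qed

end

section \<open>The exterior derivative in a chart\<close>

text \<open>Separates the coordinate calculus of the 2-form from the manifold: \<open>K\<close>
  stands for the metric coefficients of a chart, transported to its open image
  \<open>U\<close>.\<close>

locale local_metric =
  fixes U :: "'e::euclidean_space set" and K :: "'e \<Rightarrow> 'e \<Rightarrow> 'e \<Rightarrow> real"
  assumes open_U: "open U" and smooth_K: "smooth_on U (\<lambda>x. K x a b)"
    and linear_K: "x \<in> U \<Longrightarrow> linear (K x a)" and K_sym: "x \<in> U \<Longrightarrow> K x a b = K x b a"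
begin

definition dK :: "'e \<Rightarrow> 'e \<Rightarrow> 'e \<Rightarrow> 'e \<Rightarrow> real" where
  "dK a x b c = frechet_derivative (\<lambda>x. K x b c) (at x) a"

text \<open>Minus the exterior derivative of the 1-form \<open>(a, b) \<mapsto> K x y a\<close> at \<open>(x, y)\<close>.\<close>

definition Om :: "'e \<times> 'e \<Rightarrow> 'e \<times> 'e \<Rightarrow> 'e \<times> 'e \<Rightarrow> real" where
  "Om z X Y = K (fst z) (fst X) (snd Y) - K (fst z) (snd X) (fst Y)
     + dK (fst Y) (fst z) (snd z) (fst X) - dK (fst X) (fst z) (snd z) (fst Y)"

text \<open>The derivative of \<open>Om\<close> in direction \<open>X\<close> with the other two
  arguments frozen. Each \<open>dK\<close> term of \<open>Om\<close> contributes a second derivative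
  along the base part of \<open>X\<close> and a term from its linearity in the fibre
  coordinate.\<close>

definition dOm :: "'e \<times> 'e \<Rightarrow> 'e \<times> 'e \<Rightarrow> 'e \<times> 'e \<Rightarrow> 'e \<times> 'e \<Rightarrow> real" where
  "dOm z X Y Z = dK (fst X) (fst z) (fst Y) (snd Z) - dK (fst X) (fst z) (snd Y) (fst Z)
     + (frechet_derivative (\<lambda>x. dK (fst Z) x (snd z) (fst Y)) (at (fst z)) (fst X)
        + dK (fst Z) (fst z) (snd X) (fst Y))
     - (frechet_derivative (\<lambda>x. dK (fst Y) x (snd z) (fst Z)) (at (fst z)) (fst X)
        + dK (fst Y) (fst z) (snd X) (fst Z))"

lemma has_derivative_K:
  assumes "x \<in> U"
  shows "((\<lambda>x. K x a b) has_derivative (\<lambda>v. dK v x a b)) (at x)"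
  using smooth_on_differentiable[OF smooth_K assms, of a b] unfolding dK_def frechet_derivative_works by simp

lemma dK_sym:
  assumes "x \<in> U"
  shows "dK v x a b = dK v x b a"
proof -
  have "frechet_derivative (\<lambda>x. K x a b) (at x) = frechet_derivative (\<lambda>x. K x b a) (at x)"
    by (rule frechet_derivative_cong_open[OF open_U assms K_sym])
  then show ?thesis by (simp add: dK_def)
qed

lemma smooth_dK: "smooth_on U (\<lambda>x. dK v x a b)"
  unfolding dK_def by (rule smooth_on_frechet_derivative[OF smooth_K])

text \<open>Differentiate the linearity relation of \<open>K\<close> in x and compare by uniqueness
  of the derivative.\<close>

lemma linear_dK:
  assumes x: "x \<in> U"
  shows "linear (\<lambda>a. dK v x a b)"
proof
  fix a a'
  have "((\<lambda>x. K x a b + K x a' b) has_derivative (\<lambda>v. dK v x a b + dK v x a' b)) (at x)"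
    by (intro has_derivative_add has_derivative_K x)
  then have "((\<lambda>x. K x (a + a') b) has_derivative (\<lambda>v. dK v x a b + dK v x a' b)) (at x)"
    by (rule has_derivative_transform_within_open[OF _ open_U x])
      (simp add: K_sym[of _ _ b] linear_add[OF linear_K])
  from has_derivative_unique[OF this has_derivative_K[OF x]]
  show "dK v x (a + a') b = dK v x a b + dK v x a' b" by (rule fun_cong[symmetric])
next
  fix r a
  have "((\<lambda>x. r * K x a b) has_derivative (\<lambda>v. r * dK v x a b)) (at x)"
    by (intro has_derivative_mult_right has_derivative_K x)
  then have "((\<lambda>x. K x (r *\<^sub>R a) b) has_derivative (\<lambda>v. r * dK v x a b)) (at x)"
    by (rule has_derivative_transform_within_open[OF _ open_U x])
      (simp add: K_sym[of _ _ b] linear_scale[OF linear_K])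
  from has_derivative_unique[OF this has_derivative_K[OF x]]
  show "dK v x (r *\<^sub>R a) b = r *\<^sub>R dK v x a b" by (simp add: fun_eq_iff)
qed

lemma has_derivative_Om:
  assumes x: "fst z \<in> U"
  shows "((\<lambda>z. Om z Y Z) has_derivative (\<lambda>X. dOm z X Y Z)) (at z)"
proof -
  have K: "((\<lambda>z. K (fst z) a b) has_derivative (\<lambda>X. dK (fst X) (fst z) a b)) (at z)" for a b
    by (rule has_derivative_compose[where f = fst and f' = fst and g = "\<lambda>x. K x a b"])
      (auto intro!: derivative_eq_intros has_derivative_K[OF x])
  have dK: "((\<lambda>z. dK v (fst z) (snd z) b) has_derivative
      (\<lambda>X. frechet_derivative (\<lambda>x. dK v x (snd z) b) (at (fst z)) (fst X) + dK v (fst z) (snd X) b)) (at z)"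
    for v b
    using has_derivative_fibrewise_linear[OF open_U x linear_dK
        smooth_on_differentiable[OF smooth_dK x], of v b "snd z"] by simp
  show ?thesis
    unfolding Om_def dOm_def by (intro has_derivative_diff has_derivative_add K dK)
qed

text \<open>This is dd = 0 for the 1-form behind \<open>Om\<close>. In the alternating sum the
  second derivatives cancel in pairs by their symmetry, and the first derivatives by symmetry of the
  metric coefficients.\<close>

lemma Om_closed:
  assumes x: "fst z \<in> U"
  shows "dOm z X Y Z - dOm z Y X Z + dOm z Z X Y = 0"
proof -
  have comm: "frechet_derivative (\<lambda>x. dK v x a b) (at (fst z)) w =
      frechet_derivative (\<lambda>x. dK w x a b) (at (fst z)) v" for v w a b
    unfolding dK_def by (rule frechet_derivative_commute[OF open_U smooth_K x])
  show ?thesis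
    unfolding dOm_def
    using comm[of "fst Z" "snd z" "fst Y" "fst X"] comm[of "fst Y" "snd z" "fst Z" "fst X"]
      comm[of "fst Z" "snd z" "fst X" "fst Y"]
      dK_sym[OF x, of "fst X" "fst Y" "snd Z"] dK_sym[OF x, of "fst Y" "fst X" "snd Z"]
      dK_sym[OF x, of "fst Z" "fst X" "snd Y"]
    by linarith
qed

end

section \<open>The 2-form of a chart and its Lagrangian splitting\<close>

context levi_civita_structure
begin

lemma local_metric_G:
  assumes c: "c \<in> A"
  shows "local_metric (snd c ` fst c) (\<lambda>x. G c (chart_inv c x))"
proof (rule local_metric.intro)
  show "open (snd c ` fst c)" by (rule open_chart[OF c])
  show "smooth_on (snd c ` fst c) (\<lambda>x. G c (chart_inv c x) a b)" for a b by (rule smooth_G[OF c])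
  have ch: "c \<in> charts_at A (chart_inv c x)" if "x \<in> snd c ` fst c" for x
    using c that by (auto simp: charts_at_def)
  show "linear (G c (chart_inv c x) a)" if "x \<in> snd c ` fst c" for x a
    by (rule linear_G_right[OF ch[OF that]])
  show "G c (chart_inv c x) a b = G c (chart_inv c x) b a" if "x \<in> snd c ` fst c" for x a b
    by (rule G_sym[OF ch[OF that]])
qed

definition form :: "('a, 'e) chart \<Rightarrow> 'e \<times> 'e \<Rightarrow> 'e \<times> 'e \<Rightarrow> 'e \<times> 'e \<Rightarrow> real" where
  "form c = local_metric.Om (\<lambda>x. G c (chart_inv c x))"

text \<open>\<open>G_metric\<close> turns both \<open>dK\<close> terms into Christoffel terms. Those
  pairing y with \<open>Gam c p a a'\<close> and \<open>Gam c p a' a\<close> cancel by vanishing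
  torsion; the others complete b and b' to the vertical parts of the two vectors.\<close>

lemma form_eq:
  assumes c: "c \<in> charts_at A p"
  shows "form c (snd c p, y) (a, b) (a', b') =
    G c p a (b' + Gam c p a' y) - G c p (b + Gam c p a y) a'"
proof -
  note cd = charts_atD[OF c]
  interpret local_metric "snd c ` fst c" "\<lambda>x. G c (chart_inv c x)" by (rule local_metric_G[OF cd(1)])
  have dG: "dK v (snd c p) w z = G c p (Gam c p v w) z + G c p w (Gam c p v z)" for v w z
    unfolding dK_def by (rule G_metric[OF c])
  have "form c (snd c p, y) (a, b) (a', b') = G c p a b' - G c p b a' + G c p (Gam c p a' y) a - G c p (Gam c p a y) a'"
    unfolding form_def Om_def using cd by (simp add: dG Gam_sym[OF c, of a' a])
  also have "G c p (Gam c p a' y) a = G c p a (Gam c p a' y)" by (rule G_sym[OF c])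
  finally show ?thesis
    by (simp add: linear_add[OF linear_G_right[OF c]] linear_add[OF linear_G_left[OF c]])
qed

lemma orthogonal_vector:
  assumes c: "c \<in> charts_at A p" and dim: "DIM('e) > 1"
  obtains e where "e \<noteq> 0" "G c p a e = 0"
proof -
  obtain i j :: 'e where ij: "i \<in> Basis" "j \<in> Basis" "i \<noteq> j"
    using dim by (metis One_nat_def card_le_Suc0_iff_eq finite_Basis not_le)
  \<comment> \<open>Orthogonal to \<open>a\<close> by construction. Its \<open>j\<close> coefficient
    is \<open>- G c p a i\<close>, so it is nonzero unless \<open>i\<close> itself is orthogonal to
    \<open>a\<close>, in which case \<open>i\<close> is taken.\<close>
  let ?e = "G c p a j *\<^sub>R i - G c p a i *\<^sub>R j"
  have lin: "linear (G c p a)" by (rule linear_G_right[OF c])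
  show thesis
  proof (cases "G c p a i = 0")
    case True
    then show thesis using that[of i] nonzero_Basis[OF ij(1)] by blast
  next
    case False
    have "?e \<bullet> j = - G c p a i"
      using ij by (simp add: inner_diff_left inner_not_same_Basis)
    then have "?e \<noteq> 0" using False by auto
    moreover have "G c p a ?e = 0"
      by (simp add: linear_diff[OF lin] linear_scale[OF lin])
    ultimately show thesis by (rule that)
  qed
qed

text \<open>Non-degeneracy makes wedging a covector with the 2-form injective in dimension at least 4:
  test with a vector \<open>e\<close> orthogonal to the base (or fibre) direction under consideration.\<close>

lemma wedge_form_zero:
  assumes c: "c \<in> charts_at A p" and dim: "DIM('e) > 1" and \<alpha>: "linear \<alpha>"
    and wedge: "\<And>X Y Z. \<alpha> X * form c (snd c p, y) Y Z - \<alpha> Y * form c (snd c p, y) X Z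
      + \<alpha> Z * form c (snd c p, y) X Y = 0"
  shows "\<alpha> X = 0"
proof -
  define h where "h a = (a, - Gam c p a y)" for a
  have G0: "G c p a 0 = 0" "G c p 0 a = 0" for a
    using linear_0[OF linear_G_right[OF c]] linear_0[OF linear_G_left[OF c]] by auto
  have Gam0: "Gam c p 0 y = 0" using linear_0[OF linear_Gam_left[OF c]] .
  \<comment> \<open>\<open>h a\<close> is the horizontal lift in coordinates. Horizontal and
    vertical vectors are isotropic and are paired by the metric, so for the triples below only the
    term with \<alpha> on the first vector survives the choice of e.\<close>
  have F: "form c (snd c p, y) (h a) (h b) = 0" "form c (snd c p, y) (0, a) (0, b) = 0"
     "form c (snd c p, y) (h a) (0, b) = G c p a b" "form c (snd c p, y) (0, b) (h a) = - G c p b a" for a b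
    by (simp_all add: h_def form_eq[OF c] G0 Gam0)
  have hor: "\<alpha> (h a) = 0" for a
  proof -
    obtain e where e: "e \<noteq> 0" "G c p a e = 0" using orthogonal_vector[OF c dim] .
    have "\<alpha> (h a) * G c p e e = 0"
      using wedge[of "h a" "h e" "(0, e)"] e by (simp add: F)
    then show ?thesis using G_pos[OF c e(1)] by simp
  qed
  have vert: "\<alpha> (0, b) = 0" for b
  proof -
    obtain e where e: "e \<noteq> 0" "G c p b e = 0" using orthogonal_vector[OF c dim] .
    have "\<alpha> (0, b) * G c p e e = 0"
      using wedge[of "(0, b)" "h e" "(0, e)"] e by (simp add: F)
    then show ?thesis using G_pos[OF c e(1)] by simp
  qed
  have "X = h (fst X) + (0, snd X + Gam c p (fst X) y)"
    by (simp add: h_def prod_eq_iff)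
  then have "\<alpha> X = \<alpha> (h (fst X)) + \<alpha> (0, snd X + Gam c p (fst X) y)"
    using linear_add[OF \<alpha>] by metis
  then show ?thesis by (simp add: hor vert)
qed

end

section \<open>The fundamental form of the weighted structure\<close>

lemma connected_space_locally_constant:
  assumes "connected_space X"
    and loc: "\<And>p. p \<in> topspace X \<Longrightarrow> \<exists>W. openin X W \<and> p \<in> W \<and> (\<forall>q\<in>W. h q = h p)"
    and "p \<in> topspace X" "q \<in> topspace X"
  shows "h p = h q"
proof (rule ccontr)
  assume ne: "h p \<noteq> h q"
  \<comment> \<open>An arbitrary predicate covers a level set of h and its complement at once; as
    two open sets they would separate the space.\<close>
  have op: "openin X {r \<in> topspace X. P (h r)}" for P
  proof (subst openin_subopen, intro ballI)
    fix r assume r: "r \<in> {r \<in> topspace X. P (h r)}"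
    from r have "r \<in> topspace X" by blast
    then obtain W where W: "openin X W" "r \<in> W" "\<And>q. q \<in> W \<Longrightarrow> h q = h r"
      using loc[of r] by blast
    have "W \<subseteq> {r \<in> topspace X. P (h r)}"
    proof
      fix q assume q: "q \<in> W"
      then show "q \<in> {r \<in> topspace X. P (h r)}"
        unfolding mem_Collect_eq W(3)[OF q] using r openin_subset[OF W(1)] by blast
    qed
    with W show "\<exists>T. openin X T \<and> r \<in> T \<and> T \<subseteq> {r \<in> topspace X. P (h r)}" by blast
  qed
  let ?E = "{r \<in> topspace X. h r = h p}" and ?E' = "{r \<in> topspace X. h r \<noteq> h p}"
  have "topspace X \<subseteq> ?E \<union> ?E'" "?E \<inter> ?E' = {}" by auto
  moreover have "p \<in> ?E" "q \<in> ?E'" using assms(3,4) ne by auto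
  ultimately show False
    using assms(1) op[of "\<lambda>y. y = h p"] op[of "\<lambda>y. y \<noteq> h p"]
    unfolding connected_space_def by (metis empty_iff)
qed

locale weighted_structure = levi_civita_structure A gM nabla
  for A :: "('a, 'e::euclidean_space) chart set"
    and gM :: "'a \<Rightarrow> ('a, 'e) tvec \<Rightarrow> ('a, 'e) tvec \<Rightarrow> real"
    and nabla :: "'a \<Rightarrow> ('a, 'e) tvec \<Rightarrow> ('a \<Rightarrow> ('a, 'e) tvec) \<Rightarrow> ('a, 'e) tvec" +
  fixes \<mu> lam :: "'a \<times> ('a, 'e) tvec \<Rightarrow> real"
    and g :: "'a \<times> ('a, 'e) tvec \<Rightarrow> ('a \<times> ('a, 'e) tvec, 'e \<times> 'e) tvec \<Rightarrow>
              ('a \<times> ('a, 'e) tvec, 'e \<times> 'e) tvec \<Rightarrow> real"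
    and J :: "'a \<times> ('a, 'e) tvec \<Rightarrow> ('a \<times> ('a, 'e) tvec, 'e \<times> 'e) tvec \<Rightarrow>
              ('a \<times> ('a, 'e) tvec, 'e \<times> 'e) tvec"
  assumes smooth_\<mu>: "smooth_fun (tangent_atlas A) (tangent_bundle A) \<mu>"
    and smooth_lam: "smooth_fun (tangent_atlas A) (tangent_bundle A) lam"
    and \<mu>_pos: "u \<in> tangent_bundle A \<Longrightarrow> \<mu> u > 0"
    and lam_pos: "u \<in> tangent_bundle A \<Longrightarrow> lam u > 0"
    and weighted_metric: "weighted_metric A gM nabla \<mu> lam g"
    and weighted_acs: "weighted_acs A nabla \<mu> lam J"
begin

abbreviation "TA \<equiv> tangent_atlas A"

abbreviation "\<omega> \<equiv> fundamental_form g J"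

definition f :: "'a \<times> ('a, 'e) tvec \<Rightarrow> real" where
  "f u = \<mu> u * lam u"

text \<open>The weights give the same factor in both terms, (\<mu>/\<lambda>) \<lambda>^2 =
  (\<lambda>/\<mu>) \<mu>^2 = \<mu>\<lambda>, and orthogonality of horizontal and vertical lifts
  removes the rest.\<close>

lemma fundamental_form_lifts:
  assumes u: "u \<in> tangent_bundle A"
    and w: "w \<in> tangent_space A (fst u)" "z \<in> tangent_space A (fst u)"
    and w': "w' \<in> tangent_space A (fst u)" "z' \<in> tangent_space A (fst u)"
  shows "\<omega> u (tadd (horizontal_lift A nabla u w) (vertical_lift A u z))
      (tadd (horizontal_lift A nabla u w') (vertical_lift A u z')) =
    f u * (gM (fst u) w z' - gM (fst u) z w')"
proof -
  let ?p = "fst u" and ?h = "horizontal_lift A nabla u" and ?v = "vertical_lift A u"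
  let ?T = "tangent_space TA u"
  obtain c where c: "c \<in> charts_at A ?p"
    using carrier_chart u unfolding mem_tangent_bundle by blast
  have h: "?h x \<in> ?T" and v: "?v x \<in> ?T" if "x \<in> tangent_space A ?p" for x
    using horizontal_lift[OF u that c] vertical_lift[OF u that c] T.coord_vec_in[OF tangent_chart_at[OF u c]]
    by simp_all
  have sym: "symmetric_bilinear_tangent ?T (g u)"
    and hv: "\<And>x y. x \<in> tangent_space A ?p \<Longrightarrow> y \<in> tangent_space A ?p \<Longrightarrow> g u (?h x) (?v y) = 0"
    and hh: "\<And>x y. x \<in> tangent_space A ?p \<Longrightarrow> y \<in> tangent_space A ?p \<Longrightarrow>
        g u (?h x) (?h y) = (\<mu> u)\<^sup>2 * gM ?p x y"
    and vv: "\<And>x y. x \<in> tangent_space A ?p \<Longrightarrow> y \<in> tangent_space A ?p \<Longrightarrow>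
        g u (?v x) (?v y) = (lam u)\<^sup>2 * gM ?p x y"
    using bspec[OF weighted_metric[unfolded weighted_metric_def] u] by blast+
  have gs: "g u X Y = g u Y X" if "X \<in> ?T" "Y \<in> ?T" for X Y
    using sym that unfolding symmetric_bilinear_tangent_def by blast
  have gadd: "g u X (tadd Y Z) = g u X Y + g u X Z" if "X \<in> ?T" "Y \<in> ?T" "Z \<in> ?T" for X Y Z
    using sym that unfolding symmetric_bilinear_tangent_def linear_tangent_def by blast
  have gscale: "g u X (tscale r Y) = r * g u X Y" if "X \<in> ?T" "Y \<in> ?T" for X Y r
    using sym that unfolding symmetric_bilinear_tangent_def linear_tangent_def by blast
  have J: "J u (tadd (?h w) (?v z)) = tadd (J u (?h w)) (J u (?v z))"
    using bspec[OF weighted_acs[unfolded weighted_acs_def] u] h[OF w(1)] v[OF w(2)]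
    unfolding endomorphism_tangent_def by blast
  have Jh: "J u (?h w) = tscale (\<mu> u / lam u) (?v w)" and Jv: "J u (?v z) = tscale (- (lam u / \<mu> u)) (?h z)"
    using bspec[OF weighted_acs[unfolded weighted_acs_def] u] w by blast+
  \<comment> \<open>\<open>symmetric_bilinear_tangent\<close> records linearity in the second
    argument only, so \<open>Y\<close> is moved to the first slot and the image under J is expanded
    in the second.\<close>
  define Y where "Y = tadd (?h w') (?v z')"
  have Y: "Y \<in> ?T" unfolding Y_def by (intro T.tadd_in h v w')
  have YH: "g u Y (?h x) = (\<mu> u)\<^sup>2 * gM ?p x w'" if x: "x \<in> tangent_space A ?p" for x
    using gs[OF Y h[OF x]] gadd[OF h[OF x] h[OF w'(1)] v[OF w'(2)]] hh[OF x w'(1)] hv[OF x w'(2)]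
    by (simp add: Y_def)
  have YV: "g u Y (?v x) = (lam u)\<^sup>2 * gM ?p x z'" if x: "x \<in> tangent_space A ?p" for x
    using gs[OF Y v[OF x]] gadd[OF v[OF x] h[OF w'(1)] v[OF w'(2)]] vv[OF x w'(2)]
      gs[OF v[OF x] h[OF w'(1)]] hv[OF w'(1) x]
    by (simp add: Y_def)
  have "\<omega> u (tadd (?h w) (?v z)) Y =
      g u (tadd (tscale (\<mu> u / lam u) (?v w)) (tscale (- (lam u / \<mu> u)) (?h z))) Y"
    by (simp add: fundamental_form_def J Jh Jv)
  also have "\<dots> = g u Y (tadd (tscale (\<mu> u / lam u) (?v w)) (tscale (- (lam u / \<mu> u)) (?h z)))"
    by (intro gs T.tadd_in T.tscale_in h v Y w)
  also have "\<dots> = (\<mu> u / lam u) * g u Y (?v w) + (- (lam u / \<mu> u)) * g u Y (?h z)"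
    using gadd[OF Y T.tscale_in[OF v[OF w(1)]] T.tscale_in[OF h[OF w(2)]]]
      gscale[OF Y v[OF w(1)]] gscale[OF Y h[OF w(2)]] by simp
  also have "\<dots> = f u * (gM ?p w z' - gM ?p z w')"
    using \<mu>_pos[OF u] lam_pos[OF u] YV[OF w(1)] YH[OF w(2)]
    by (simp add: f_def power2_eq_square algebra_simps)
  finally show ?thesis by (simp add: Y_def)
qed

text \<open>A coordinate vector (a, b) is the horizontal lift of a plus the vertical lift of b +
  \<open>Gam\<close>(a, y). Inserting this into the formula on lifts gives exactly the shape of
  \<open>form_eq\<close>.\<close>

lemma fundamental_form_chart:
  assumes u: "u \<in> tangent_bundle A" and c: "c \<in> charts_at A (fst u)"
  shows "\<omega> u (coord_vec TA (tangent_chart A c) u X) (coord_vec TA (tangent_chart A c) u Y) =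
    f u * form c (snd (tangent_chart A c) u) X Y"
proof -
  let ?p = "fst u" and ?t = "tangent_chart A c"
  let ?Gam = "\<lambda>a. Gam c ?p a (snd u c)"
  have t: "?t \<in> charts_at TA u" by (rule tangent_chart_at[OF u c])
  have split: "coord_vec TA ?t u Z = tadd (horizontal_lift A nabla u (coord_vec A c ?p (fst Z)))
      (vertical_lift A u (coord_vec A c ?p (snd Z + ?Gam (fst Z))))" for Z
    unfolding horizontal_lift[OF u coord_vec_in[OF c] c] vertical_lift[OF u coord_vec_in[OF c] c]
      T.coord_vec_add[OF t, symmetric] by (simp add: coord_vec_self[OF c])
  show ?thesis
    unfolding split fundamental_form_lifts[OF u coord_vec_in[OF c] coord_vec_in[OF c] coord_vec_in[OF c] coord_vec_in[OF c]]
    using form_eq[OF c, of "snd u c" "fst X" "snd X" "fst Y" "snd Y"]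
    by (simp add: G_def snd_tangent_chart)
qed

definition df :: "('a, 'e) chart \<Rightarrow> 'e \<times> 'e \<Rightarrow> 'e \<times> 'e \<Rightarrow> real" where
  "df c z = frechet_derivative (f \<circ> chart_inv (tangent_chart A c)) (at z)"

lemma has_derivative_f:
  assumes c: "c \<in> A" and z: "z \<in> snd c ` fst c \<times> UNIV"
  shows "((f \<circ> chart_inv (tangent_chart A c)) has_derivative df c z) (at z)"
proof -
  have "tangent_chart A c \<in> TA" using c by (simp add: tangent_atlas_def)
  moreover have "tangent_bundle A \<inter> fst (tangent_chart A c) = fst (tangent_chart A c)"
    by (auto simp: fst_tangent_chart)
  ultimately have sm: "smooth_on (snd c ` fst c \<times> UNIV) (h \<circ> chart_inv (tangent_chart A c))"
    if "smooth_fun TA (tangent_bundle A) h" for h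
    using that tangent_chart_image[OF c] unfolding smooth_fun_def by metis
  have "(\<lambda>z. (\<mu> \<circ> chart_inv (tangent_chart A c)) z * (lam \<circ> chart_inv (tangent_chart A c)) z)
      differentiable (at z)"
    by (intro differentiable_mult smooth_on_differentiable[OF sm z] smooth_\<mu> smooth_lam)
  moreover have "(\<lambda>z. (\<mu> \<circ> chart_inv (tangent_chart A c)) z * (lam \<circ> chart_inv (tangent_chart A c)) z) =
      f \<circ> chart_inv (tangent_chart A c)"
    by (rule ext) (simp add: f_def)
  ultimately show ?thesis by (simp add: df_def frechet_derivative_works)
qed

text \<open>The Leibniz rule d(f \<Omega>) = df \<and> \<Omega> + f d\<Omega> with \<Omega> =
  \<open>form c\<close>, whose own exterior derivative vanishes by \<open>Om_closed\<close>.\<close>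

lemma ext_deriv_fundamental_form:
  assumes u: "u \<in> tangent_bundle A" and c: "c \<in> charts_at A (fst u)"
  defines "t \<equiv> tangent_chart A c"
  defines "z \<equiv> snd t u"
  shows "ext_deriv TA t \<omega> u X Y Z =
    df c z (X t) * form c z (Y t) (Z t) - df c z (Y t) * form c z (X t) (Z t)
      + df c z (Z t) * form c z (X t) (Y t)"
proof -
  note cd = charts_atD[OF c]
  interpret K: local_metric "snd c ` fst c" "\<lambda>x. G c (chart_inv c x)" by (rule local_metric_G[OF cd(1)])
  let ?S = "snd c ` fst c \<times> (UNIV :: 'e set)"
  have S: "open ?S" using open_chart[OF cd(1)] by (intro open_Times) auto
  have z: "z \<in> ?S" using cd by (simp add: z_def t_def snd_tangent_chart)
  have uz: "chart_inv t z = u"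
    unfolding z_def t_def by (rule T.chart_inv_chart) (use u cd in \<open>auto simp: tangent_atlas_def fst_tangent_chart\<close>)
  have "chart_deriv t u V (\<lambda>q. \<omega> q (coord_vec TA t q a) (coord_vec TA t q b)) =
      f u * K.dOm z (V t) a b + df c z (V t) * form c z a b" for V a b
  proof -
    have "((\<lambda>z. (f \<circ> chart_inv t) z * form c z a b) has_derivative
        (\<lambda>v. (f \<circ> chart_inv t) z * K.dOm z v a b + df c z v * form c z a b)) (at z)"
      unfolding form_def t_def
      by (intro has_derivative_mult has_derivative_f cd K.has_derivative_Om) (use z in auto)
    then have "(((\<lambda>q. \<omega> q (coord_vec TA t q a) (coord_vec TA t q b)) \<circ> chart_inv t) has_derivative
        (\<lambda>v. (f \<circ> chart_inv t) z * K.dOm z v a b + df c z v * form c z a b)) (at z)"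
    proof (rule has_derivative_transform_within_open[OF _ S z])
      fix z' assume "z' \<in> ?S"
      then obtain q y where q: "q \<in> fst c" "z' = (snd c q, y)" by auto
      then have cq: "c \<in> charts_at A q" using cd by (simp add: charts_at_def)
      have inv: "chart_inv t z' = (q, coord_vec A c q y)"
        using q cd unfolding t_def by (simp add: chart_inv_tangent_chart)
      have "snd t (chart_inv t z') = z'"
        unfolding inv by (simp add: t_def snd_tangent_chart coord_vec_self[OF cq] q)
      then show "(f \<circ> chart_inv t) z' * form c z' a b =
          ((\<lambda>q. \<omega> q (coord_vec TA t q a) (coord_vec TA t q b)) \<circ> chart_inv t) z'"
        using fundamental_form_chart[of "chart_inv t z'" c a b] coord_vec_in_tangent_bundle[OF cq, of y] cq
        unfolding o_def inv t_def[symmetric] by simp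
    qed
    note chart = frechet_derivative_at[OF this, symmetric]
    show ?thesis
      unfolding chart_deriv_def z_def[symmetric] chart by (simp add: uz)
  qed
  note D = this
  have zero: "K.dOm z (X t) (Y t) (Z t) - K.dOm z (Y t) (X t) (Z t) + K.dOm z (Z t) (X t) (Y t) = 0"
    by (rule K.Om_closed) (use z in auto)
  have "ext_deriv TA t \<omega> u X Y Z =
    f u * (K.dOm z (X t) (Y t) (Z t) - K.dOm z (Y t) (X t) (Z t) + K.dOm z (Z t) (X t) (Y t)) +
    (df c z (X t) * form c z (Y t) (Z t) - df c z (Y t) * form c z (X t) (Z t)
      + df c z (Z t) * form c z (X t) (Y t))"
    unfolding ext_deriv_def D by (simp add: algebra_simps)
  then show ?thesis unfolding zero by simp
qed

lemma closed_if_constant: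
  assumes k: "\<And>u. u \<in> tangent_bundle A \<Longrightarrow> f u = k"
  shows "closed_form TA \<omega>"
  unfolding closed_form_def
proof (intro ballI)
  fix t u X Y Z assume t: "t \<in> TA" and ut: "u \<in> fst t"
  then obtain c where c: "c \<in> A" "t = tangent_chart A c" by (auto simp: tangent_atlas_def)
  then have u: "u \<in> tangent_bundle A" "c \<in> charts_at A (fst u)"
    using ut by (auto simp: fst_tangent_chart charts_at_def)
  let ?z = "snd t u"
  let ?S = "snd c ` fst c \<times> (UNIV :: 'e set)"
  have S: "open ?S" using open_chart[OF c(1)] by (intro open_Times) auto
  have z: "?z \<in> ?S" using charts_atD[OF u(2)] by (simp add: c snd_tangent_chart)
  \<comment> \<open>f equals k only on the tangent bundle, so the comparison with a constant
    function is made on the open image of the chart.\<close>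
  have "((\<lambda>_. k) has_derivative (\<lambda>_. 0)) (at ?z)" by (rule has_derivative_const)
  then have "((f \<circ> chart_inv t) has_derivative (\<lambda>_. 0)) (at ?z)"
  proof (rule has_derivative_transform_within_open[OF _ S z])
    fix z' assume "z' \<in> ?S"
    then obtain q y where q: "q \<in> fst c" "z' = (snd c q, y)" by auto
    then have "c \<in> charts_at A q" using c by (simp add: charts_at_def)
    from k[OF coord_vec_in_tangent_bundle[OF this, of y]] show "k = (f \<circ> chart_inv t) z'"
      using q c by (simp add: chart_inv_tangent_chart)
  qed
  then have "df c ?z = (\<lambda>_. 0)"
    unfolding df_def c(2)[symmetric] by (rule frechet_derivative_at[symmetric])
  then show "ext_deriv TA t \<omega> u X Y Z = 0"
    using ext_deriv_fundamental_form[OF u, of X Y Z] by (simp add: c)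
qed

text \<open>Every triple of model vectors occurs as components of tangent vectors at u, so
  closedness yields the wedge identity for all arguments and \<open>wedge_form_zero\<close> applies
  to the covector \<open>df c z\<close>.\<close>

lemma df_zero_if_closed:
  assumes dim: "DIM('e) > 1" and closed: "closed_form TA \<omega>"
    and c: "c \<in> A" and z: "z \<in> snd c ` fst c \<times> UNIV"
  shows "df c z = (\<lambda>_. 0)"
proof
  fix V
  obtain q y where q: "q \<in> fst c" "z = (snd c q, y)" using z by auto
  have cq: "c \<in> charts_at A q" using c q by (simp add: charts_at_def)
  let ?t = "tangent_chart A c"
  define u where "u = (q, coord_vec A c q y)"
  have u: "u \<in> tangent_bundle A" "c \<in> charts_at A (fst u)"
    using coord_vec_in_tangent_bundle[OF cq] cq by (auto simp: u_def)
  have t: "?t \<in> charts_at TA u" by (rule tangent_chart_at[OF u])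
  have zu: "snd ?t u = z" by (simp add: u_def snd_tangent_chart coord_vec_self[OF cq] q)
  show "df c z V = 0"
  proof (rule wedge_form_zero[OF cq dim])
    show "linear (df c z)" using has_derivative_f[OF c z] by (rule has_derivative_linear)
    fix X Y Z
    let ?C = "coord_vec TA ?t u"
    have "ext_deriv TA ?t \<omega> u (?C X) (?C Y) (?C Z) = 0"
      using closed T.charts_atD[OF t] T.coord_vec_in[OF t] unfolding closed_form_def by blast
    then show "df c z X * form c (snd c q, y) Y Z - df c z Y * form c (snd c q, y) X Z
        + df c z Z * form c (snd c q, y) X Y = 0"
      unfolding ext_deriv_fundamental_form[OF u] T.coord_vec_self[OF t] zu q(2)[symmetric] .
  qed
qed

section \<open>From a vanishing derivative to constancy on the bundle\<close>

lemma openin_chart_preimage: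
  assumes c: "c \<in> A" and V: "open V"
  shows "openin (manifold_topology A) {q \<in> fst c. snd c q \<in> V}"
  unfolding openin_manifold_topology[OF smooth_atlas]
proof (intro conjI ballI)
  show "{q \<in> fst c. snd c q \<in> V} \<subseteq> carrier A" using c by (auto simp: carrier_def)
  fix d assume d: "d \<in> A"
  let ?S = "snd d ` (fst d \<inter> fst c)"
  have "open (?S \<inter> (snd c \<circ> chart_inv d) -` V)"
    using smooth_on_continuous_on[OF smooth_transition[OF d c]] open_overlap[OF d c] V
    by (rule continuous_open_preimage)
  moreover have "snd d ` ({q \<in> fst c. snd c q \<in> V} \<inter> fst d) = ?S \<inter> (snd c \<circ> chart_inv d) -` V"
    using d by auto
  ultimately show "open (snd d ` ({q \<in> fst c. snd c q \<in> V} \<inter> fst d))" by simp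
qed

text \<open>A coordinate ball times the whole fibre is convex, so a vanishing derivative makes f
  constant over the full preimage of the ball. Hence f is determined by its values on the zero
  section.\<close>

lemma constant_if_closed:
  assumes dim: "DIM('e) > 1" and conn: "connected_space (manifold_topology A)"
    and closed: "closed_form TA \<omega>"
  shows "f constant_on tangent_bundle A"
proof -
  have loc: "\<exists>W. openin (manifold_topology A) W \<and> p \<in> W \<and>
      (\<forall>u\<in>tangent_bundle A. fst u \<in> W \<longrightarrow> f u = f (p, tzero))" if p: "p \<in> carrier A" for p
  proof -
    obtain c where c: "c \<in> charts_at A p" using carrier_chart[OF p] by blast
    note cd = charts_atD[OF c]
    obtain r where r: "r > 0" "ball (snd c p) r \<subseteq> snd c ` fst c"
      using open_chart[OF cd(1)] cd(2) openE by blast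
    let ?t = "tangent_chart A c"
    let ?V = "ball (snd c p) r \<times> (UNIV :: 'e set)"
    have "\<exists>k. \<forall>z\<in>?V. (f \<circ> chart_inv ?t) z = k"
    proof (rule has_derivative_zero_constant)
      show "convex ?V" by (intro convex_Times) auto
      fix z assume "z \<in> ?V"
      then have z: "z \<in> snd c ` fst c \<times> UNIV" using r by auto
      have "((f \<circ> chart_inv ?t) has_derivative (\<lambda>_. 0)) (at z)"
        using has_derivative_f[OF cd(1) z] df_zero_if_closed[OF dim closed cd(1) z] by simp
      then show "((f \<circ> chart_inv ?t) has_derivative (\<lambda>h. 0)) (at z within ?V)"
        by (rule has_derivative_at_withinI)
    qed
    then obtain k where k: "\<And>z. z \<in> ?V \<Longrightarrow> (f \<circ> chart_inv ?t) z = k" by blast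
    have fk: "f u = k" if u: "u \<in> tangent_bundle A" "fst u \<in> fst c" "snd c (fst u) \<in> ball (snd c p) r" for u
    proof -
      have "chart_inv ?t (snd ?t u) = u"
        by (rule T.chart_inv_chart) (use u cd in \<open>auto simp: tangent_atlas_def fst_tangent_chart\<close>)
      then show ?thesis using k[of "snd ?t u"] u(3) by (simp add: snd_tangent_chart)
    qed
    have "(p, tzero) \<in> tangent_bundle A" using p tzero_in by (simp add: mem_tangent_bundle)
    then have "f (p, tzero) = k" by (rule fk) (use cd r in auto)
    then show ?thesis
      using openin_chart_preimage[OF cd(1) open_ball, of "snd c p" r] cd r(1) fk
      by (intro exI[of _ "{q \<in> fst c. snd c q \<in> ball (snd c p) r}"]) auto
  qed
  have top: "topspace (manifold_topology A) = carrier A"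
    by (rule topspace_manifold_topology[OF smooth_atlas])
  \<comment> \<open>Along the zero section f is a locally constant function on the connected
    base.\<close>
  have zero: "f (p, tzero) = f (q, tzero)" if "p \<in> carrier A" "q \<in> carrier A" for p q
  proof (rule connected_space_locally_constant[OF conn, of "\<lambda>p. f (p, tzero)"])
    show "p \<in> topspace (manifold_topology A)" "q \<in> topspace (manifold_topology A)"
      using that top by auto
    fix p assume "p \<in> topspace (manifold_topology A)"
    then have "p \<in> carrier A" using top by simp
    from loc[OF this] obtain W where W: "openin (manifold_topology A) W" "p \<in> W"
      "\<And>u. u \<in> tangent_bundle A \<Longrightarrow> fst u \<in> W \<Longrightarrow> f u = f (p, tzero)"
      by blast
    have "f (q, tzero) = f (p, tzero)" if q: "q \<in> W" for q
    proof (rule W(3))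
      show "(q, tzero) \<in> tangent_bundle A" "fst (q, tzero) \<in> W"
        using q openin_subset_carrier[OF W(1)] tzero_in by (auto simp: mem_tangent_bundle)
    qed
    then show "\<exists>W. openin (manifold_topology A) W \<and> p \<in> W \<and> (\<forall>q\<in>W. f (q, tzero) = f (p, tzero))"
      by (intro exI[of _ W] conjI ballI W(1,2))
  qed
  have fibre: "f u = f (fst u, tzero)" if u: "u \<in> tangent_bundle A" for u
  proof -
    have "fst u \<in> carrier A" using u by (simp add: mem_tangent_bundle)
    from loc[OF this] u show ?thesis by blast
  qed
  have "f u = f v" if "u \<in> tangent_bundle A" "v \<in> tangent_bundle A" for u v
    unfolding fibre[OF that(1)] fibre[OF that(2)]
    by (rule zero) (use that in \<open>simp_all add: mem_tangent_bundle\<close>)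
  then show ?thesis unfolding constant_on_def by blast
qed

end

theorem theorem2p1:
  fixes A :: "('a, 'e::euclidean_space) chart set"
    and gM :: "'a \<Rightarrow> ('a, 'e) tvec \<Rightarrow> ('a, 'e) tvec \<Rightarrow> real"
    and nabla :: "'a \<Rightarrow> ('a, 'e) tvec \<Rightarrow> ('a \<Rightarrow> ('a, 'e) tvec) \<Rightarrow> ('a, 'e) tvec"
    and \<mu> lam :: "'a \<times> ('a, 'e) tvec \<Rightarrow> real"
    and g :: "'a \<times> ('a, 'e) tvec \<Rightarrow> ('a \<times> ('a, 'e) tvec, 'e \<times> 'e) tvec \<Rightarrow>
              ('a \<times> ('a, 'e) tvec, 'e \<times> 'e) tvec \<Rightarrow> real"
    and J :: "'a \<times> ('a, 'e) tvec \<Rightarrow> ('a \<times> ('a, 'e) tvec, 'e \<times> 'e) tvec \<Rightarrow>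
              ('a \<times> ('a, 'e) tvec, 'e \<times> 'e) tvec"
  assumes "smooth_manifold A"
    and "connected_space (manifold_topology A)"
    and "DIM('e) > 1"
    and "riemannian_metric A gM"
    and "levi_civita A gM nabla"
    and "smooth_fun (tangent_atlas A) (tangent_bundle A) \<mu>"
    and "smooth_fun (tangent_atlas A) (tangent_bundle A) lam"
    and "\<forall>u\<in>tangent_bundle A. \<mu> u > 0"
    and "\<forall>u\<in>tangent_bundle A. lam u > 0"
    and "weighted_metric A gM nabla \<mu> lam g"
    and "weighted_acs A nabla \<mu> lam J"
  shows "closed_form (tangent_atlas A) (fundamental_form g J) \<longleftrightarrow>
         (\<lambda>u. \<mu> u * lam u) constant_on tangent_bundle A"
proof -
  interpret weighted_structure A gM nabla \<mu> lam g J
    using assms by unfold_locales (auto simp: smooth_manifold_def)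
  have f: "(\<lambda>u. \<mu> u * lam u) = f" by (rule ext) (simp add: f_def)
  show ?thesis
    unfolding f
  proof
    assume "closed_form (tangent_atlas A) (fundamental_form g J)"
    then show "f constant_on tangent_bundle A" by (rule constant_if_closed[OF assms(3,2)])
  next
    assume "f constant_on tangent_bundle A"
    then obtain k where "\<And>u. u \<in> tangent_bundle A \<Longrightarrow> f u = k" unfolding constant_on_def by blast
    then show "closed_form (tangent_atlas A) (fundamental_form g J)" by (rule closed_if_constant)
  qed
qed

end
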